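(* Let $k\ge 1$ and $n\ge k+1$ be integers, and let $t=\left\lfloor \frac{n}{k+1}\right\rfloor$. Then $$\mathrm{sat}(n,\mathcal{F}'_k)=(k-1)(n-1)-t\binom{k-1}{2},$$ with equality achieved (that is, the minimum number of edges is attained) for $k=1$ by the edgeless graph $\overline{K}_n$, for $k=2$ by every $n$-vertex tree, and for $k\ge 3$ by the graph $G_{k,n}$ defined in the context.
   Context: All graphs are finite and simple (no loops or multiedges). For a positive integer $k$, $\mathcal{F}'_k$ is the family of $k$-edge-connected graphs; a $k$-edge-connected graph is a graph with at least two vertices that remains connected after deletion of any set of fewer than $k$ edges (so a single vertex is not in $\mathcal{F}'_k$). Given a family $\mathcal{F}$ of graphs, a graph $G$ is $\mathcal{F}$-saturated if (1) no subgraph of $G$ belongs to $\mathcal{F}$, and (2) for every edge $e$ of the complement $\overline{G}$, the graph $G+e$ contains a subgraph belonging to $\mathcal{F}$. The saturation number $\mathrm{sat}(n,\mathcal{F})$ is the minimum number of edges in an $n$-vertex $\mathcal{F}$-saturated graph. $K_{k+1}^-$ denotes the graph obtained from the complete graph $K_{k+1}$ by deleting one edge, and $[m]=\{1,\dots,m\}$. Definition of $G_{k,n}$ for $k\ge 3$ and $n\ge k+1$: let $t=\lfloor n/(k+1)\rfloor$ and $r=n-t(k+1)$. For $i\in[t]$, let $H_i$ be a copy of $K_{k+1}^-$ on vertices $u_{i,1},\dots,u_{i,k+1}$, in which $u_{i,1}$ and $u_{i,k+1}$ are the nonadjacent pair. Let $F_t$ be obtained from the disjoint union $H_1+\cdots+H_t$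 by adding the edge $u_{i,j}u_{i+1,j}$ for all $i\in[t-1]$ and all $j\in[k+1]\setminus\{2,k\}$. Then $G_{k,n}$ is obtained from $F_t$ by adding $r$ new vertices $w_1,\dots,w_r$, each having neighborhood exactly $V(H_t)\setminus\{u_{t,1},u_{t,k+1}\}$. *)

theory Defs
  imports Complex_Main
begin

type_synonym 'a graph = "'a set \<times> 'a set set"

abbreviation verts :: "'a graph \<Rightarrow> 'a set" where "verts \<equiv> fst"
abbreviation edges :: "'a graph \<Rightarrow> 'a set set" where "edges \<equiv> snd"

definition complete_graph :: "'a set \<Rightarrow> 'a graph" where
  "complete_graph V = (V, {{x, y} | x y. x \<in> V \<and> y \<in> V \<and> x \<noteq> y})"

definition simple_graph :: "'a graph \<Rightarrow> bool" where
  "simple_graph G \<longleftrightarrow> finite (verts G) \<and> edges G \<subseteq> edges (complete_graph (verts G))"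

definition subgraph :: "'a graph \<Rightarrow> 'a graph \<Rightarrow> bool" where
  "subgraph H G \<longleftrightarrow> simple_graph H \<and> simple_graph G \<and>
     verts H \<subseteq> verts G \<and> edges H \<subseteq> edges G"

definition complement_edges :: "'a graph \<Rightarrow> 'a set set" where
  "complement_edges G = edges (complete_graph (verts G)) - edges G"

definition add_edge :: "'a graph \<Rightarrow> 'a set \<Rightarrow> 'a graph" where
  "add_edge G e = (verts G, insert e (edges G))"

definition delete_edges :: "'a graph \<Rightarrow> 'a set set \<Rightarrow> 'a graph" where
  "delete_edges G D = (verts G, edges G - D)"

definition connected_graph :: "'a graph \<Rightarrow> bool" where
  "connected_graph G \<longleftrightarrow> verts G \<noteq> {} \<and>
     (\<forall>x \<in> verts G. \<forall>y \<in> verts G. (x, y) \<in> {(a, b). {a, b} \<in> edges G}\<^sup>*)"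

definition edge_connected :: "nat \<Rightarrow> 'a graph \<Rightarrow> bool" where
  "edge_connected k G \<longleftrightarrow> simple_graph G \<and> 2 \<le> card (verts G) \<and>
     (\<forall>D \<subseteq> edges G. card D < k \<longrightarrow> connected_graph (delete_edges G D))"

definition edge_connected_family :: "nat \<Rightarrow> 'a graph set" where
  "edge_connected_family k = {G. edge_connected k G}"

definition saturated :: "'a graph set \<Rightarrow> 'a graph \<Rightarrow> bool" where
  "saturated \<F> G \<longleftrightarrow> simple_graph G \<and>
     (\<nexists>H. subgraph H G \<and> H \<in> \<F>) \<and>
     (\<forall>e \<in> complement_edges G. \<exists>H. subgraph H (add_edge G e) \<and> H \<in> \<F>)"

text \<open>Vertices are taken from \<^typ>\<open>nat\<close>, which realizes every finite graph up to isomorphism.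
  The value is meaningful only if some saturated graph on \<open>n\<close> vertices exists;
  \<open>attains_sat\<close> asserts that a given graph is one of minimum size.\<close>

definition sat :: "nat \<Rightarrow> nat graph set \<Rightarrow> nat" where
  "sat n \<F> = (LEAST m. \<exists>G. saturated \<F> G \<and> card (verts G) = n \<and> card (edges G) = m)"

definition attains_sat :: "nat \<Rightarrow> nat graph set \<Rightarrow> nat graph \<Rightarrow> bool" where
  "attains_sat n \<F> G \<longleftrightarrow> saturated \<F> G \<and> card (verts G) = n \<and> card (edges G) = sat n \<F>"

text \<open>A cycle is given by the cyclic sequence of its vertices.\<close>

definition is_cycle :: "'a graph \<Rightarrow> 'a list \<Rightarrow> bool" where
  "is_cycle G xs \<longleftrightarrow> 3 \<le> length xs \<and> distinct xs \<and> set xs \<subseteq> verts G \<and>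
     (\<forall>i < length xs. {xs ! i, xs ! (Suc i mod length xs)} \<in> edges G)"

definition tree :: "'a graph \<Rightarrow> bool" where
  "tree G \<longleftrightarrow> simple_graph G \<and> connected_graph G \<and> (\<nexists>xs. is_cycle G xs)"

text \<open>The vertices of \<open>G\<^bsub>k,n\<^esub>\<close> are numbered \<open>1, \<dots>, n\<close>: the block of \<open>H\<^sub>i\<close> is
  \<open>(i-1)(k+1)+1, \<dots>, i(k+1)\<close>, and the \<open>w\<^sub>l\<close> come after all \<open>t\<close> blocks.
  The labels \<open>i\<close>, \<open>j\<close>, \<open>l\<close> start at 1.\<close>

definition u_vertex :: "nat \<Rightarrow> nat \<Rightarrow> nat \<Rightarrow> nat" where
  "u_vertex k i j = (i - 1) * (k + 1) + j"

definition w_vertex :: "nat \<Rightarrow> nat \<Rightarrow> nat \<Rightarrow> nat" where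
  "w_vertex k t l = t * (k + 1) + l"

definition H_graph :: "nat \<Rightarrow> nat \<Rightarrow> nat graph" where
  "H_graph k i = delete_edges (complete_graph (u_vertex k i ` {1..k+1}))
     {{u_vertex k i 1, u_vertex k i (k+1)}}"

definition F_graph :: "nat \<Rightarrow> nat \<Rightarrow> nat graph" where
  "F_graph k t =
     (\<Union>i \<in> {1..t}. verts (H_graph k i),
      (\<Union>i \<in> {1..t}. edges (H_graph k i)) \<union>
      {{u_vertex k i j, u_vertex k (i+1) j} | i j. i \<in> {1..t-1} \<and> j \<in> {1..k+1} - {2, k}})"

definition G_graph :: "nat \<Rightarrow> nat \<Rightarrow> nat graph" where
  "G_graph k n =
     (let t = n div (k + 1); r = n - t * (k + 1) in
       (verts (F_graph k t) \<union> w_vertex k t ` {1..r},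
        edges (F_graph k t) \<union>
        {{w_vertex k t l, x} | l x. l \<in> {1..r} \<and>
           x \<in> verts (H_graph k t) - {u_vertex k t 1, u_vertex k t (k+1)}}))"

end

theory Submission
  imports Defs "HOL-Library.Transitive_Closure_Table"
begin

text \<open>A graph with at least two vertices is \<open>k\<close>-edge-connected iff every edge cut has at least
  \<open>k\<close> edges (\<open>edge_connected_iff_cut\<close>). Hence a \<open>k\<close>-edge-connected subgraph never meets both sides
  of a cut with fewer than \<open>k\<close> edges, and everything is an analysis of such small cuts.

  Lower bound (\<open>saturated_edges_lower_bound\<close>). A saturated graph with at most \<open>k\<close> vertices is
  complete. In a saturated graph with at least \<open>k\<close> vertices a cut of size less than \<open>k\<close> has exactly
  \<open>k - 1\<close> edges, since a new edge across a smaller one could not create a \<open>k\<close>-edge-connected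
  subgraph, and both sides of the cut are again saturated. Induct on the number \<open>n > k\<close> of vertices.
  If some vertex has degree less than \<open>k\<close>, it has degree \<open>k - 1\<close> and can be removed; for
  \<open>n = k + 1\<close> what remains is a complete graph, and this is the only place where the count drops
  by \<open>(k - 1) choose 2\<close> below \<open>(k - 1) * (n - 1)\<close>. If all degrees are at least \<open>k\<close>, a set
  of at most \<open>k\<close> vertices has at least \<open>k\<close> edges leaving it, so both sides of a small cut
  have at least \<open>k + 1\<close> vertices and the induction hypothesis applies to both. The total loss is
  governed by the superadditivity of \<open>n div (k + 1)\<close>.

  For \<open>k \<le> 2\<close> the loss is zero, and a graph without \<open>k\<close>-edge-connected subgraph that has
  \<open>(k - 1) * (n - 1)\<close> edges is saturated because no such graph has more
  (\<open>card_edges_le_of_not_has_ec\<close>, \<open>saturated_of_max_edges\<close>). This covers edgeless graphs and trees.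

  For \<open>k \<ge> 3\<close> the graph is assembled by joining two saturated graphs by \<open>k - 1\<close> edges
  (\<open>saturated_join\<close>): only the missing edges between the two parts have to be tested. Inside one
  almost complete block, or between an additional vertex \<open>w\<^sub>l\<close> and another vertex
  \<open>w\<^sub>m\<close> or the last block, a missing edge completes a clique on \<open>k + 1\<close> vertices.
  A missing edge between different blocks, or between some \<open>w\<^sub>l\<close> and an earlier block, makes the whole stretch of blocks between its ends
  \<open>k\<close>-edge-connected: by \<open>chain_small_cut\<close> a small cut of a stretch separates its first block from
  its last one and has at least \<open>k - 1\<close> edges, and the addition supplies one more.\<close>

section \<open>Edge cuts\<close>

definition edge_cut :: "'a graph \<Rightarrow> 'a set \<Rightarrow> 'a set set" where
  "edge_cut G S = {e \<in> edges G. e \<inter> S \<noteq> {} \<and> \<not> e \<subseteq> S}"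

definition induced :: "'a graph \<Rightarrow> 'a set \<Rightarrow> 'a graph" where
  "induced G S = (S, {e \<in> edges G. e \<subseteq> S})"

definition cross :: "'a set \<Rightarrow> 'a set \<Rightarrow> 'a set set" where
  "cross A B = (\<lambda>(x, y). {x, y}) ` (A \<times> B)"

lemma simple_graph_iff:
  "simple_graph G \<longleftrightarrow> finite (verts G) \<and>
     (\<forall>e\<in>edges G. \<exists>x y. e = {x, y} \<and> x \<in> verts G \<and> y \<in> verts G \<and> x \<noteq> y)"
  unfolding simple_graph_def complete_graph_def by auto

lemma simple_edgeE:
  assumes "simple_graph G" "e \<in> edges G"
  obtains x y where "e = {x, y}" "x \<in> verts G" "y \<in> verts G" "x \<noteq> y"
proof -
  have "\<exists>x y. e = {x, y} \<and> x \<in> verts G \<and> y \<in> verts G \<and> x \<noteq> y"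
    using assms unfolding simple_graph_iff by simp
  then show thesis using that by blast
qed

lemma simple_finite: "simple_graph G \<Longrightarrow> finite (verts G)"
  unfolding simple_graph_def by simp

lemma edge_subset: "simple_graph G \<Longrightarrow> e \<in> edges G \<Longrightarrow> e \<subseteq> verts G"
  by (erule (1) simple_edgeE) simp

lemma edge_nonempty: "simple_graph G \<Longrightarrow> e \<in> edges G \<Longrightarrow> e \<noteq> {}"
  by (erule (1) simple_edgeE) simp

lemma finite_edges:
  assumes "simple_graph G" shows "finite (edges G)"
proof -
  have "edges G \<subseteq> Pow (verts G)" using edge_subset[OF assms] by blast
  then show ?thesis using simple_finite[OF assms] by (meson finite_Pow_iff finite_subset)
qed

lemma finite_cut: "simple_graph G \<Longrightarrow> finite (edge_cut G S)"
  unfolding edge_cut_def by (simp add: finite_edges)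

lemma cut_mono: "edges H \<subseteq> edges G \<Longrightarrow> edge_cut H S \<subseteq> edge_cut G S"
  unfolding edge_cut_def by auto

lemma edge_cutE:
  assumes "simple_graph G" "e \<in> edge_cut G S"
  obtains x y where "e = {x, y}" "x \<in> verts G" "y \<in> verts G" "x \<in> S" "y \<notin> S"
proof -
  have e: "e \<in> edges G" "e \<inter> S \<noteq> {}" "\<not> e \<subseteq> S" using assms unfolding edge_cut_def by auto
  obtain x y where "e = {x, y}" "x \<in> verts G" "y \<in> verts G"
    using simple_edgeE[OF assms(1) e(1)] .
  with e that[of x y] that[of y x] show thesis by (auto simp: insert_commute)
qed

lemma card_cross:
  assumes "A \<inter> B = {}" shows "card (cross A B) = card A * card B"
proof -
  have "inj_on (\<lambda>(x, y). {x, y}) (A \<times> B)"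
    using assms by (auto simp: inj_on_def doubleton_eq_iff)
  then show ?thesis unfolding cross_def by (simp add: card_image card_cartesian_product)
qed

lemma finite_cross: "finite A \<Longrightarrow> finite B \<Longrightarrow> finite (cross A B)"
  unfolding cross_def by simp

lemma cross_iff: "e \<in> cross A B \<longleftrightarrow> (\<exists>x\<in>A. \<exists>y\<in>B. e = {x, y})"
  unfolding cross_def by auto

text \<open>Used for the \<open>a * b\<close> pairs between the two sides of a partition of \<open>a + b\<close> vertices.\<close>
lemma pred_le_mult: "1 \<le> a \<Longrightarrow> 1 \<le> b \<Longrightarrow> a + b - 1 \<le> a * (b::nat)"
proof -
  assume "1 \<le> a" "1 \<le> b"
  then obtain a' b' where "a = Suc a'" "b = Suc b'" by (metis Suc_le_D One_nat_def)
  then show ?thesis by simp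
qed

lemma card_split:
  assumes "finite V" "V \<inter> S \<noteq> {}" "V - S \<noteq> {}"
  shows "1 \<le> card (V \<inter> S)" "1 \<le> card (V - S)" "card (V \<inter> S) + card (V - S) = card V"
proof -
  show "1 \<le> card (V \<inter> S)" "1 \<le> card (V - S)"
    using assms by (simp_all add: Suc_le_eq card_gt_0_iff)
  show "card (V \<inter> S) + card (V - S) = card V"
    using assms(1) by (metis card_Int_Diff)
qed

text \<open>Deleting a cut disconnects the graph; conversely, if deleting \<open>D\<close> leaves \<open>x\<close> and \<open>y\<close> in
  different components, then \<open>D\<close> contains the cut around the component of \<open>x\<close>.\<close>
lemma edge_connected_iff_cut:
  "edge_connected k G \<longleftrightarrow> simple_graph G \<and> 2 \<le> card (verts G) \<and>
     (\<forall>S. verts G \<inter> S \<noteq> {} \<and> verts G - S \<noteq> {} \<longrightarrow> k \<le> card (edge_cut G S))"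
proof (intro iffI conjI allI impI; (elim conjE)?)
  assume ec: "edge_connected k G"
  show "simple_graph G" "2 \<le> card (verts G)" using ec unfolding edge_connected_def by auto
  fix S assume S: "verts G \<inter> S \<noteq> {}" "verts G - S \<noteq> {}"
  show "k \<le> card (edge_cut G S)"
  proof (rule ccontr)
    assume "\<not> k \<le> card (edge_cut G S)"
    then have con: "connected_graph (delete_edges G (edge_cut G S))"
      using ec unfolding edge_connected_def edge_cut_def by auto
    obtain x y where xy: "x \<in> verts G" "x \<in> S" "y \<in> verts G" "y \<notin> S" using S by auto
    have "(x, y) \<in> {(a, b). {a, b} \<in> edges (delete_edges G (edge_cut G S))}\<^sup>*"
      using con xy unfolding connected_graph_def by (auto simp: delete_edges_def)
    then have "y \<in> S"
      by (induction rule: rtrancl_induct) (use xy in \<open>auto simp: delete_edges_def edge_cut_def\<close>)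
    then show False using xy by simp
  qed
next
  assume sg: "simple_graph G" and c: "2 \<le> card (verts G)"
    and cuts: "\<forall>S. verts G \<inter> S \<noteq> {} \<and> verts G - S \<noteq> {} \<longrightarrow> k \<le> card (edge_cut G S)"
  have "connected_graph (delete_edges G D)" if D: "D \<subseteq> edges G" "card D < k" for D
    unfolding connected_graph_def
  proof (intro conjI ballI)
    show "verts (delete_edges G D) \<noteq> {}" using c by (auto simp: delete_edges_def)
    fix x y assume "x \<in> verts (delete_edges G D)" "y \<in> verts (delete_edges G D)"
    then have xy: "x \<in> verts G" "y \<in> verts G" by (auto simp: delete_edges_def)
    let ?R = "{(a, b). {a, b} \<in> edges (delete_edges G D)}"
    define S where "S = {z. (x, z) \<in> ?R\<^sup>*}"
    have "edge_cut G S \<subseteq> D"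
    proof
      fix e assume e: "e \<in> edge_cut G S"
      obtain a b where ab: "e = {a, b}" "a \<in> S" "b \<notin> S" using edge_cutE[OF sg e] .
      have "(a, b) \<notin> ?R"
      proof
        assume "(a, b) \<in> ?R"
        then have "(x, b) \<in> ?R\<^sup>*"
          using ab(2) rtrancl_into_rtrancl[of x a ?R b] unfolding S_def by simp
        then show False using ab(3) unfolding S_def by simp
      qed
      then show "e \<in> D" using e ab by (auto simp: delete_edges_def edge_cut_def)
    qed
    then have "card (edge_cut G S) < k"
      using D card_mono[of D "edge_cut G S"] finite_subset[OF D(1) finite_edges[OF sg]] by linarith
    moreover have "x \<in> S" unfolding S_def by simp
    ultimately have "y \<in> S" using cuts xy by (metis DiffI Int_iff empty_iff not_le)
    then show "(x, y) \<in> ?R\<^sup>*" unfolding S_def by simp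
  qed
  then show "edge_connected k G" using sg c unfolding edge_connected_def by auto
qed

lemma cut_complete: "edge_cut (complete_graph V) S = cross (V \<inter> S) (V - S)"
proof (intro set_eqI iffI)
  fix e assume "e \<in> edge_cut (complete_graph V) S"
  then obtain x y where "e = {x, y}" "x \<in> V" "y \<in> V" "e \<inter> S \<noteq> {}" "\<not> e \<subseteq> S"
    unfolding edge_cut_def complete_graph_def by auto
  then show "e \<in> cross (V \<inter> S) (V - S)" unfolding cross_iff
    by (cases "x \<in> S") (auto intro: insert_commute)
next
  fix e assume "e \<in> cross (V \<inter> S) (V - S)"
  then show "e \<in> edge_cut (complete_graph V) S"
    unfolding cross_iff edge_cut_def complete_graph_def by auto
qed

lemma simple_complete: "finite V \<Longrightarrow> simple_graph (complete_graph V)"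
  unfolding simple_graph_def by (simp add: complete_graph_def)

lemma edge_connected_complete:
  assumes "card V = k + 1" "1 \<le> k"
  shows "edge_connected k (complete_graph V)"
proof -
  have fin: "finite V" using assms card_ge_0_finite by force
  have "k \<le> card (edge_cut (complete_graph V) S)" if "V \<inter> S \<noteq> {}" "V - S \<noteq> {}" for S
    using card_split[OF fin that] pred_le_mult[of "card (V \<inter> S)" "card (V - S)"] assms
    by (simp add: cut_complete card_cross Int_Diff_disjoint)
  then show ?thesis
    unfolding edge_connected_iff_cut using assms simple_complete[OF fin]
    by (auto simp: complete_graph_def)
qed

lemma card_edges_complete: "finite V \<Longrightarrow> card (edges (complete_graph V)) = card V choose 2"
proof -
  assume "finite V"
  moreover have "edges (complete_graph V) = {e. e \<subseteq> V \<and> card e = 2}"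
    unfolding complete_graph_def by (auto simp: card_2_iff)
  ultimately show ?thesis by (simp add: n_subsets)
qed

lemma simple_induced: "simple_graph G \<Longrightarrow> S \<subseteq> verts G \<Longrightarrow> simple_graph (induced G S)"
  unfolding simple_graph_iff
proof (intro conjI ballI)
  assume sg: "finite (verts G) \<and>
    (\<forall>e\<in>edges G. \<exists>x y. e = {x, y} \<and> x \<in> verts G \<and> y \<in> verts G \<and> x \<noteq> y)" and S: "S \<subseteq> verts G"
  show "finite (verts (induced G S))" using sg S by (simp add: induced_def finite_subset)
  fix e assume e: "e \<in> edges (induced G S)"
  then obtain x y where "e = {x, y}" "x \<noteq> y" using sg by (auto simp: induced_def)
  then show "\<exists>x y. e = {x, y} \<and> x \<in> verts (induced G S) \<and> y \<in> verts (induced G S) \<and> x \<noteq> y"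
    using e by (auto simp: induced_def)
qed

lemma subgraph_induced: "simple_graph G \<Longrightarrow> S \<subseteq> verts G \<Longrightarrow> subgraph (induced G S) G"
  unfolding subgraph_def using simple_induced[of G S] by (simp add: induced_def)

lemma subgraph_trans: "subgraph A B \<Longrightarrow> subgraph B C \<Longrightarrow> subgraph A C"
  unfolding subgraph_def by blast

lemma card_edges_split:
  assumes "simple_graph G" "S \<subseteq> verts G"
  shows "card (edges G) =
    card (edges (induced G S)) + card (edges (induced G (verts G - S))) + card (edge_cut G S)"
proof -
  let ?A = "edges (induced G S)" and ?B = "edges (induced G (verts G - S))"
  have eq: "edges G = (?A \<union> ?B) \<union> edge_cut G S"
    using edge_subset[OF assms(1)] unfolding induced_def edge_cut_def by auto
  have fin: "finite ?A" "finite ?B" "finite (edge_cut G S)"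
    using finite_edges[OF assms(1)] by (auto simp: induced_def edge_cut_def)
  have dis: "?A \<inter> ?B = {}" "(?A \<union> ?B) \<inter> edge_cut G S = {}"
    using edge_nonempty[OF assms(1)] unfolding induced_def edge_cut_def by auto
  show ?thesis using fin dis by (subst eq) (simp add: card_Un_disjoint)
qed

section \<open>Graphs without a k-edge-connected subgraph\<close>

definition has_ec :: "nat \<Rightarrow> 'a graph \<Rightarrow> bool" where
  "has_ec k G \<longleftrightarrow> (\<exists>H. subgraph H G \<and> edge_connected k H)"

lemma saturated_ec_iff:
  "saturated (edge_connected_family k) G \<longleftrightarrow> simple_graph G \<and> \<not> has_ec k G \<and>
     (\<forall>e\<in>complement_edges G. has_ec k (add_edge G e))"
  unfolding saturated_def has_ec_def edge_connected_family_def by auto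

lemma has_ec_mono: "has_ec k G \<Longrightarrow> subgraph G G' \<Longrightarrow> has_ec k G'"
  unfolding has_ec_def using subgraph_trans by blast

text \<open>If \<open>H\<close> met both sides, its own cut would have at least \<open>k\<close> edges, all of them in the cut
  of \<open>G\<close>.\<close>
lemma edge_connected_one_side:
  assumes "edge_connected k H" "subgraph H G" "card (edge_cut G S) < k"
  shows "verts H \<subseteq> S \<or> verts H \<inter> S = {}"
proof (rule ccontr)
  assume "\<not> ?thesis"
  then have "k \<le> card (edge_cut H S)" using assms(1) unfolding edge_connected_iff_cut by blast
  also have "\<dots> \<le> card (edge_cut G S)"
    using assms(2) by (intro card_mono finite_cut cut_mono) (auto simp: subgraph_def)
  finally show False using assms(3) by simp
qed

lemma subgraph_into_induced:
  assumes "subgraph H G" "verts H \<subseteq> S" "S \<subseteq> verts G"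
  shows "subgraph H (induced G S)"
proof -
  have "edges H \<subseteq> Pow (verts H)"
    using assms(1) edge_subset[of H] unfolding subgraph_def by blast
  then show ?thesis
    using assms simple_induced[of G S] unfolding subgraph_def by (auto simp: induced_def)
qed

lemma has_ec_one_side:
  assumes "has_ec k G" "card (edge_cut G S) < k" "S \<subseteq> verts G"
  shows "has_ec k (induced G S) \<or> has_ec k (induced G (verts G - S))"
proof -
  obtain H where H: "subgraph H G" "edge_connected k H" using assms unfolding has_ec_def by auto
  have "verts H \<subseteq> S \<or> verts H \<subseteq> verts G - S"
    using edge_connected_one_side[OF H(2,1) assms(2)] H(1) unfolding subgraph_def by blast
  then show ?thesis
    using subgraph_into_induced[OF H(1)] assms(3) H(2) unfolding has_ec_def
    by (metis Diff_subset)
qed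

lemma edge_connected_degree:
  assumes "edge_connected k H" "subgraph H G" "v \<in> verts H"
  shows "k \<le> card (edge_cut G {v})"
proof (rule ccontr)
  assume "\<not> ?thesis"
  then have "verts H \<subseteq> {v}" using edge_connected_one_side[OF assms(1,2), of "{v}"] assms(3) by auto
  then have "card (verts H) \<le> 1" using card_mono[of "{v}" "verts H"] by simp
  then show False using assms(1) unfolding edge_connected_iff_cut by simp
qed

text \<open>In a graph on at most \<open>k\<close> vertices every degree is less than \<open>k\<close>.\<close>
lemma small_not_has_ec:
  assumes "card (verts G) \<le> k"
  shows "\<not> has_ec k G"
proof
  assume "has_ec k G"
  then obtain H where H: "subgraph H G" "edge_connected k H" unfolding has_ec_def by blast
  then have sg: "simple_graph H" "simple_graph G" and c2: "2 \<le> card (verts H)"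
    unfolding edge_connected_iff_cut subgraph_def by auto
  have c: "card (verts H) \<le> k"
    using assms H(1) card_mono[of "verts G" "verts H"] simple_finite[OF sg(2)]
    unfolding subgraph_def by auto
  obtain v where v: "v \<in> verts H" using c2 by fastforce
  have fin: "finite (verts H)" using simple_finite sg by blast
  have "subgraph H H" using sg unfolding subgraph_def by simp
  then have "k \<le> card (edge_cut H {v})" using edge_connected_degree[OF H(2) _ v] by blast
  also have "\<dots> \<le> card (cross {v} (verts H - {v}))"
  proof (rule card_mono)
    show "finite (cross {v} (verts H - {v}))" using fin by (simp add: finite_cross)
    show "edge_cut H {v} \<subseteq> cross {v} (verts H - {v})"
      by (auto simp: cross_iff elim!: edge_cutE[OF sg(1)])
  qed
  also have "\<dots> = card (verts H) - 1" using v fin by (simp add: card_cross)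
  finally show False using c c2 by linarith
qed

lemma exists_small_cut:
  assumes "simple_graph G" "\<not> has_ec k G" "2 \<le> card (verts G)"
  obtains S where "S \<noteq> {}" "S \<subset> verts G" "card (edge_cut G S) < k"
proof -
  have "subgraph G G" using assms unfolding subgraph_def by simp
  then have "\<not> edge_connected k G" using assms unfolding has_ec_def by blast
  then obtain S where S: "verts G \<inter> S \<noteq> {}" "verts G - S \<noteq> {}" "card (edge_cut G S) < k"
    using assms unfolding edge_connected_iff_cut by (meson not_le)
  have "edge_cut G (verts G \<inter> S) = edge_cut G S"
    using edge_subset[OF assms(1)] unfolding edge_cut_def by auto
  with S show ?thesis using that[of "verts G \<inter> S"] by auto
qed

text \<open>Splitting along a small cut loses at most \<open>k - 1\<close> edges, and \<open>n - 1\<close> splittings reduce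
  the graph to single vertices.\<close>
lemma card_edges_le_of_not_has_ec:
  assumes "simple_graph G" "\<not> has_ec k G" "1 \<le> card (verts G)"
  shows "card (edges G) \<le> (k - 1) * (card (verts G) - 1)"
  using assms
proof (induction "card (verts G)" arbitrary: G rule: less_induct)
  case less
  have fin: "finite (verts G)" using simple_finite less.prems(1) by blast
  show ?case
  proof (cases "card (verts G) = 1")
    case True
    then obtain v where "verts G = {v}" using card_1_singletonE by blast
    then have "edges G = {}" using simple_edgeE[OF less.prems(1)] by (metis equals0I singletonD)
    then show ?thesis by simp
  next
    case False
    then obtain S where S: "S \<noteq> {}" "S \<subset> verts G" "card (edge_cut G S) < k"
      using exists_small_cut[OF less.prems(1,2)] less.prems(3)
      by (metis One_nat_def Suc_leI le_neq_implies_less numeral_2_eq_2)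
    let ?T = "verts G - S"
    have cards: "1 \<le> card S" "1 \<le> card ?T" "card S + card ?T = card (verts G)"
      using card_split[OF fin, of S] S by (auto simp: Int_absorb1 psubset_imp_subset)
    have IH: "card (edges (induced G X)) \<le> (k - 1) * (card X - 1)"
      if "X \<subseteq> verts G" "1 \<le> card X" "card X < card (verts G)" for X
      using less.hyps[of "induced G X"] that simple_induced[OF less.prems(1) that(1)]
        has_ec_mono[OF _ subgraph_induced[OF less.prems(1) that(1)]] less.prems(2)
      by (auto simp: induced_def)
    have "card (edges G) \<le> (k - 1) * (card S - 1) + (k - 1) * (card ?T - 1) + (k - 1)"
      using card_edges_split[OF less.prems(1), of S] IH[of S] IH[of ?T] cards S by fastforce
    also have "\<dots> = (k - 1) * ((card S - 1) + (card ?T - 1) + 1)" by (simp add: algebra_simps)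
    also have "(card S - 1) + (card ?T - 1) + 1 = card (verts G) - 1" using cards by linarith
    finally show ?thesis .
  qed
qed

lemma simple_add_edge:
  "simple_graph G \<Longrightarrow> e \<in> complement_edges G \<Longrightarrow> simple_graph (add_edge G e)"
  unfolding simple_graph_def complement_edges_def add_edge_def complete_graph_def by auto

text \<open>One more edge would exceed the bound of \<open>card_edges_le_of_not_has_ec\<close>.\<close>
lemma saturated_of_max_edges:
  assumes "simple_graph G" "\<not> has_ec k G" "card (edges G) = (k - 1) * (card (verts G) - 1)"
  shows "saturated (edge_connected_family k) G"
  unfolding saturated_ec_iff
proof (intro conjI ballI)
  fix e assume e: "e \<in> complement_edges G"
  then have "verts G \<noteq> {}" unfolding complement_edges_def complete_graph_def by auto
  then have "1 \<le> card (verts G)"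
    using assms(1) by (simp add: simple_finite Suc_le_eq card_gt_0_iff)
  moreover have "card (edges (add_edge G e)) = card (edges G) + 1"
    using e finite_edges[OF assms(1)] by (simp add: complement_edges_def add_edge_def)
  ultimately show "has_ec k (add_edge G e)"
    using card_edges_le_of_not_has_ec[OF simple_add_edge[OF assms(1) e]] assms(3)
    by (fastforce simp: add_edge_def)
qed (use assms in auto)

section \<open>Splitting and joining saturated graphs\<close>

text \<open>An added edge creates no subgraph of the family on so few vertices, so nothing can be missing.\<close>
lemma saturated_small_complete:
  assumes "saturated (edge_connected_family k) G" "card (verts G) \<le> k"
  shows "edges G = edges (complete_graph (verts G))"
proof -
  have "complement_edges G = {}"
    using assms small_not_has_ec[of "add_edge G _" k] unfolding saturated_ec_iff
    by (auto simp: add_edge_def)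
  then show ?thesis
    using assms(1) unfolding saturated_ec_iff simple_graph_def complement_edges_def by blast
qed

lemma saturated_complete:
  assumes "finite V" "card V \<le> k"
  shows "saturated (edge_connected_family k) (complete_graph V)"
  unfolding saturated_ec_iff using simple_complete[OF assms(1)]
    small_not_has_ec[of "complete_graph V" k] assms
  by (auto simp: complement_edges_def) (auto simp: complete_graph_def)

text \<open>A new edge across a cut of size less than \<open>k - 1\<close> lies in no \<open>k\<close>-edge-connected subgraph,
  and with at least \<open>k\<close> vertices such a cut cannot contain all pairs between its sides.\<close>
lemma saturated_cut_card:
  assumes sat: "saturated (edge_connected_family k) G" and n: "k \<le> card (verts G)"
    and S: "S \<noteq> {}" "S \<subset> verts G" "card (edge_cut G S) < k"
  shows "card (edge_cut G S) = k - 1"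
proof (rule ccontr)
  assume "card (edge_cut G S) \<noteq> k - 1"
  then have lt: "card (edge_cut G S) < k - 1" using S by linarith
  have sg: "simple_graph G" using sat saturated_ec_iff by blast
  have fin: "finite (verts G)" using simple_finite sg by blast
  have cards: "1 \<le> card S" "1 \<le> card (verts G - S)" "card S + card (verts G - S) = card (verts G)"
    using card_split[OF fin, of S] S by (auto simp: Int_absorb1 psubset_imp_subset)
  have "k - 1 \<le> card (cross S (verts G - S))"
    using pred_le_mult[OF cards(1,2)] cards(3) n by (simp add: card_cross)
  then have "\<not> cross S (verts G - S) \<subseteq> edge_cut G S"
    using lt card_mono[OF finite_cut[OF sg], of "cross S (verts G - S)" S] by linarith
  then obtain x y where xy: "x \<in> S" "y \<in> verts G - S" "{x, y} \<notin> edges G"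
    by (auto simp: subset_iff cross_iff edge_cut_def)
  let ?e = "{x, y}"
  have e: "?e \<in> complement_edges G"
    using xy S unfolding complement_edges_def complete_graph_def by auto
  then obtain H where H: "subgraph H (add_edge G ?e)" "edge_connected k H"
    using sat unfolding saturated_ec_iff has_ec_def by blast
  have "edge_cut (add_edge G ?e) S \<subseteq> insert ?e (edge_cut G S)" unfolding edge_cut_def add_edge_def by auto
  then have "card (edge_cut (add_edge G ?e) S) \<le> card (insert ?e (edge_cut G S))"
    using finite_cut[OF sg, of S] by (intro card_mono) auto
  also have "\<dots> < k" using lt finite_cut[OF sg, of S] by (auto simp: card_insert_if)
  finally have "verts H \<subseteq> S \<or> verts H \<inter> S = {}" using edge_connected_one_side[OF H(2,1)] by simp
  then have "?e \<notin> edges H"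
    using edge_subset[of H ?e] H(1) xy unfolding subgraph_def by auto
  then have "subgraph H G" using H(1) sg unfolding subgraph_def add_edge_def by auto
  then show False using H(2) sat unfolding saturated_ec_iff has_ec_def by blast
qed

text \<open>A \<open>k\<close>-edge-connected subgraph created by an edge inside \<open>S\<close> stays on one side, since
  the edge does not change the cut; and it must contain the new edge.\<close>
lemma saturated_induced:
  assumes sat: "saturated (edge_connected_family k) G"
    and S: "S \<subseteq> verts G" "card (edge_cut G S) < k"
  shows "saturated (edge_connected_family k) (induced G S)"
  unfolding saturated_ec_iff
proof (intro conjI ballI)
  have sg: "simple_graph G" and free: "\<not> has_ec k G" using sat by (simp_all add: saturated_ec_iff)
  show "simple_graph (induced G S)" using simple_induced sg S by blast
  show "\<not> has_ec k (induced G S)" using free has_ec_mono subgraph_induced[OF sg S(1)] by blast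
  fix e assume e': "e \<in> complement_edges (induced G S)"
  then have e: "e \<in> complement_edges G" "e \<subseteq> S"
    using S unfolding complement_edges_def complete_graph_def by (auto simp: induced_def)
  then have "has_ec k (add_edge G e)" using sat by (simp add: saturated_ec_iff)
  moreover have "edge_cut (add_edge G e) S = edge_cut G S"
    using e unfolding edge_cut_def add_edge_def by auto
  ultimately have "has_ec k (induced (add_edge G e) S)
      \<or> has_ec k (induced (add_edge G e) (verts G - S))"
    using has_ec_one_side[of k "add_edge G e" S] S by (auto simp: add_edge_def)
  moreover have "induced (add_edge G e) S = add_edge (induced G S) e"
    using e by (auto simp: induced_def add_edge_def)
  moreover have "induced (add_edge G e) (verts G - S) = induced G (verts G - S)"
    using e unfolding complement_edges_def complete_graph_def
    by (auto simp: induced_def add_edge_def)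
  moreover have "\<not> has_ec k (induced G (verts G - S))"
    using free has_ec_mono subgraph_induced[OF sg, of "verts G - S"] by blast
  ultimately show "has_ec k (add_edge (induced G S) e)" by simp
qed

lemma cut_compl:
  "simple_graph G \<Longrightarrow> edge_cut G (verts G - S) = edge_cut G S"
  unfolding edge_cut_def using edge_subset by fastforce

text \<open>Missing edges inside one part are handled by the saturation of that part, so only pairs
  between the parts have to be tested. The small cut \<open>C\<close> keeps \<open>k\<close>-edge-connected subgraphs of
  the join inside one part.\<close>
lemma saturated_join:
  fixes V1 V2 :: "'a set"
  assumes sat1: "saturated (edge_connected_family k) (V1, E1)"
    and sat2: "saturated (edge_connected_family k) (V2, E2)"
    and dis: "V1 \<inter> V2 = {}" and C: "C \<subseteq> cross V1 V2" "card C < k"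
    and new: "\<And>x y. x \<in> V1 \<Longrightarrow> y \<in> V2 \<Longrightarrow> {x, y} \<notin> C \<Longrightarrow>
       has_ec k (add_edge (V1 \<union> V2, E1 \<union> E2 \<union> C) {x, y})"
  shows "saturated (edge_connected_family k) (V1 \<union> V2, E1 \<union> E2 \<union> C)"
    and "card (E1 \<union> E2 \<union> C) = card E1 + card E2 + card C"
proof -
  let ?G = "(V1 \<union> V2, E1 \<union> E2 \<union> C)"
  have sg1: "simple_graph (V1, E1)" and sg2: "simple_graph (V2, E2)"
    
    using sat1 sat2 by (simp_all add: saturated_ec_iff)
  have sg: "simple_graph ?G"
    unfolding simple_graph_iff
  proof (intro conjI ballI)
    show "finite (verts ?G)" using simple_finite[OF sg1] simple_finite[OF sg2] by simp
    fix e assume "e \<in> edges ?G"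
    then consider "e \<in> E1" | "e \<in> E2" | "e \<in> cross V1 V2" using C(1) by auto
    then show "\<exists>x y. e = {x, y} \<and> x \<in> verts ?G \<and> y \<in> verts ?G \<and> x \<noteq> y"
    proof cases
      case 1
      then show ?thesis using simple_edgeE[OF sg1, of e] by (metis UnCI fst_conv snd_conv)
    next
      case 2
      then show ?thesis using simple_edgeE[OF sg2, of e] by (metis UnCI fst_conv snd_conv)
    next
      case 3
      then obtain x y where "x \<in> V1" "y \<in> V2" "e = {x, y}" unfolding cross_iff by blast
      moreover from this have "x \<noteq> y" using dis by auto
      ultimately show ?thesis by (intro exI[of _ x] exI[of _ y]) simp
    qed
  qed
  have E1: "e \<subseteq> V1 \<and> e \<noteq> {}" if "e \<in> E1" for e
    using edge_subset[OF sg1] edge_nonempty[OF sg1] that by auto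
  have E2: "e \<subseteq> V2 \<and> e \<noteq> {}" if "e \<in> E2" for e
    using edge_subset[OF sg2] edge_nonempty[OF sg2] that by auto
  have C': "e \<inter> V1 \<noteq> {} \<and> e \<inter> V2 \<noteq> {}" if "e \<in> C" for e
    using C(1) that unfolding cross_def by auto
  have cut: "edge_cut ?G V1 = C" 
  proof (intro set_eqI iffI)
    fix e assume "e \<in> edge_cut ?G V1"
    then show "e \<in> C" using E1[of e] E2[of e] dis unfolding edge_cut_def by auto
  next
    fix e assume "e \<in> C"
    then show "e \<in> edge_cut ?G V1" using C'[of e] dis unfolding edge_cut_def by auto
  qed
  have not1: "\<not> e \<subseteq> V1" if "e \<in> E2 \<union> C" for e using that E2[of e] C'[of e] dis by auto
  have not2: "\<not> e \<subseteq> V2" if "e \<in> E1 \<union> C" for e using that E1[of e] C'[of e] dis by auto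
  have i1: "induced ?G V1 = (V1, E1)"
    unfolding induced_def using E1 not1 by auto
  have "{e \<in> E1 \<union> E2 \<union> C. e \<subseteq> V2} = E2" using E2 not2 by auto
  moreover have V2: "verts ?G - V1 = V2" using dis by auto
  ultimately have i2: "induced ?G (verts ?G - V1) = (V2, E2)" unfolding induced_def by simp
  show "card (E1 \<union> E2 \<union> C) = card E1 + card E2 + card C"
    using card_edges_split[OF sg, of V1] unfolding cut i1 i2 by simp
  have free: "\<not> has_ec k ?G"
    using has_ec_one_side[of k ?G V1] sat1 sat2 C(2) unfolding cut i1 i2 saturated_ec_iff by auto
  have mono: "has_ec k (add_edge ?G e)"
    if "has_ec k (add_edge (V, E) e)" "(V, E) = (V1, E1) \<or> (V, E) = (V2, E2)"
      "e \<in> complement_edges ?G" "e \<in> complement_edges (V, E)" for V E e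
  proof (rule has_ec_mono[OF that(1)])
    show "subgraph (add_edge (V, E) e) (add_edge ?G e)"
      using that(2) simple_add_edge[OF sg that(3)] simple_add_edge[OF _ that(4)] sg1 sg2
      unfolding subgraph_def add_edge_def by auto
  qed
  have "has_ec k (add_edge ?G e)" if e: "e \<in> complement_edges ?G" for e
  proof -
    obtain x y where xy: "e = {x, y}" "x \<noteq> y" "x \<in> V1 \<union> V2" "y \<in> V1 \<union> V2" "e \<notin> E1 \<union> E2 \<union> C"
      using e unfolding complement_edges_def complete_graph_def by auto
    then consider "x \<in> V1 \<and> y \<in> V1" | "x \<in> V2 \<and> y \<in> V2" | "x \<in> V1 \<and> y \<in> V2" | "x \<in> V2 \<and> y \<in> V1"
      by blast
    then show ?thesis
    proof cases
      case 1
      then have "e \<in> complement_edges (V1, E1)"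
        using xy unfolding complement_edges_def complete_graph_def by auto
      then show ?thesis using mono[of V1 E1 e] sat1 e unfolding saturated_ec_iff by blast
    next
      case 2
      then have "e \<in> complement_edges (V2, E2)"
        using xy unfolding complement_edges_def complete_graph_def by auto
      then show ?thesis using mono[of V2 E2 e] sat2 e unfolding saturated_ec_iff by blast
    next
      case 3
      then show ?thesis using new[of x y] xy by blast
    next
      case 4
      then show ?thesis using new[of y x] xy by (simp add: insert_commute)
    qed
  qed
  then show "saturated (edge_connected_family k) ?G"
    unfolding saturated_ec_iff using sg free by blast
qed

section \<open>The lower bound\<close>

text \<open>Each of the \<open>a \<le> k\<close> vertices of \<open>A\<close> has at most \<open>a - 1\<close> neighbours inside \<open>A\<close>, so at least
  \<open>a * (k - (a - 1)) \<ge> k\<close> edges leave \<open>A\<close>.\<close>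
lemma card_cut_small_set:
  assumes sg: "simple_graph G" and A: "A \<subseteq> verts G" "1 \<le> card A" "card A \<le> k"
    and deg: "\<And>v. v \<in> verts G \<Longrightarrow> k \<le> card (edge_cut G {v})"
  shows "k \<le> card (edge_cut G A)"
proof -
  have finA: "finite A" using A(2) card_ge_0_finite by force
  let ?D = "\<lambda>v. edge_cut G {v} \<inter> edge_cut G A"
  have D: "k - (card A - 1) \<le> card (?D v)" if v: "v \<in> A" for v
  proof -
    have "edge_cut G {v} \<subseteq> ?D v \<union> cross {v} (A - {v})"
    proof
      fix e assume e: "e \<in> edge_cut G {v}"
      then obtain w where "e = {v, w}" "w \<noteq> v" "e \<in> edges G"
        by (elim edge_cutE[OF sg]) (use e in \<open>auto simp: edge_cut_def\<close>)
      then show "e \<in> ?D v \<union> cross {v} (A - {v})"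
        using v e by (cases "w \<in> A") (auto simp: edge_cut_def cross_iff)
    qed
    then have "card (edge_cut G {v}) \<le> card (?D v \<union> cross {v} (A - {v}))"
      using finA finite_cut[OF sg] by (intro card_mono) (auto simp: finite_cross)
    also have "\<dots> \<le> card (?D v) + card (cross {v} (A - {v}))" by (rule card_Un_le)
    also have "card (cross {v} (A - {v})) = card A - 1" using v finA by (simp add: card_cross)
    finally show ?thesis using deg[of v] v A(1) by auto
  qed
  have "k \<le> card A * (k - (card A - 1))"
    using pred_le_mult[of "card A" "k - (card A - 1)"] A by auto
  also have "\<dots> \<le> (\<Sum>v\<in>A. card (?D v))"
    using sum_mono[of A "\<lambda>_. k - (card A - 1)" "\<lambda>v. card (?D v)"] D by simp
  also have "\<dots> = card (\<Union>v\<in>A. ?D v)"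
  proof (rule card_UN_disjoint[symmetric])
    show "\<forall>v\<in>A. \<forall>w\<in>A. v \<noteq> w \<longrightarrow> ?D v \<inter> ?D w = {}"
    proof (intro ballI impI equals0I)
      fix v w e assume vw: "v \<in> A" "w \<in> A" "v \<noteq> w" and e: "e \<in> ?D v \<inter> ?D w"
      then have "e \<in> edge_cut G A" "v \<in> e" "w \<in> e" by (auto simp: edge_cut_def)
      then show False using vw by (elim edge_cutE[OF sg]) auto
    qed
  qed (use finA finite_cut[OF sg] in auto)
  also have "\<dots> \<le> card (edge_cut G A)" using finite_cut[OF sg] by (intro card_mono) auto
  finally show ?thesis .
qed

text \<open>The number of edges of a complete graph on \<open>k\<close> vertices with an additional vertex of degree
  \<open>k - 1\<close> falls short of \<open>(k - 1) * k\<close> by exactly \<open>(k - 1) choose 2\<close>.\<close>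
lemma choose_two_add_pred:
  assumes "1 \<le> (k :: nat)"
  shows "(k choose 2) + (k - 1) + ((k - 1) choose 2) = (k - 1) * k"
proof -
  obtain m where k: "k = Suc m" using assms by (metis Suc_le_D One_nat_def)
  have "2 * (i choose 2) = i * (i - 1)" for i :: nat
    using dvd_mult_div_cancel[of 2 "i * (i - 1)"] by (cases i) (simp_all add: choose_two)
  then have "2 * ((k choose 2) + (k - 1) + ((k - 1) choose 2)) = 2 * ((k - 1) * k)"
    unfolding k by (cases m) (simp_all add: algebra_simps)
  then show ?thesis by simp
qed

text \<open>Remove a vertex of degree less than \<open>k\<close> if there is one; otherwise split along a small cut,
  whose two sides then have more than \<open>k\<close> vertices.\<close>
lemma saturated_edges_lower_bound:
  assumes "1 \<le> k" "saturated (edge_connected_family k) G" "k + 1 \<le> card (verts G)"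
  shows "(k - 1) * (card (verts G) - 1)
    \<le> card (edges G) + card (verts G) div (k + 1) * ((k - 1) choose 2)"
  using assms
proof (induction "card (verts G)" arbitrary: G rule: less_induct)
  case less
  let ?n = "card (verts G)" and ?c = "(k - 1) choose 2"
  have sg: "simple_graph G" and free: "\<not> has_ec k G" 
    using less.prems(2) by (simp_all add: saturated_ec_iff)
  have fin: "finite (verts G)" using simple_finite sg by blast
  have IH: "(k - 1) * (card X - 1) \<le> card (edges (induced G X)) + card X div (k + 1) * ?c"
    if "X \<subseteq> verts G" "card (edge_cut G X) < k" "card X < ?n" "k + 1 \<le> card X" for X
    using less.hyps[of "induced G X"] saturated_induced[OF less.prems(2) that(1,2)] that less.prems(1)
    by (simp add: induced_def)
  show ?case
  proof (cases "\<exists>v\<in>verts G. card (edge_cut G {v}) < k")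
    case True
    then obtain v where v: "v \<in> verts G" "card (edge_cut G {v}) < k" by blast
    let ?X = "verts G - {v}"
    have "{v} \<noteq> verts G" 
    proof
      assume "{v} = verts G"
      then have "?n = card {v}" by simp
      then show False using less.prems(1,3) by simp
    qed
    then have "{v} \<subset> verts G" using v by auto
    then have deg: "card (edge_cut G {v}) = k - 1"
      using saturated_cut_card[OF less.prems(2), of "{v}"] v less.prems(3) by simp
    have cX: "card ?X = ?n - 1" using v fin by simp
    have cutX: "card (edge_cut G ?X) < k" using v cut_compl[OF sg, of "{v}"] by simp
    have E: "card (edges G) \<ge> card (edges (induced G ?X)) + (k - 1)"
      using card_edges_split[OF sg, of "{v}"] v deg by simp
    show ?thesis
    proof (cases "?n = k + 1")
      case True
      have "edges (induced G ?X) = edges (complete_graph ?X)"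
        using saturated_small_complete[OF saturated_induced[OF less.prems(2) _ cutX]] cX True
        by (simp add: induced_def)
      then have "card (edges (induced G ?X)) = k choose 2"
        using card_edges_complete[of ?X] cX True fin by simp
      then show ?thesis using E True choose_two_add_pred[OF less.prems(1)] by simp
    next
      case False
      then have nk: "k + 1 \<le> card ?X" "card ?X < ?n" using less.prems(3) cX by linarith+
      have "(k - 1) * (?n - 1) = (k - 1) * (card ?X - 1) + (k - 1)"
        using nk cX by (metis One_nat_def Suc_diff_1 add.commute add_gr_0 diff_Suc_1 less_le_trans
            mult_Suc_right zero_less_one)
      also have "\<dots> \<le> card (edges (induced G ?X)) + card ?X div (k + 1) * ?c + (k - 1)"
        using IH[OF _ cutX nk(2,1)] by simp
      also have "\<dots> \<le> card (edges G) + ?n div (k + 1) * ?c"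
        using E mult_le_mono1[OF div_le_mono[of "card ?X" ?n "k + 1"], of ?c] nk by linarith
      finally show ?thesis .
    qed
  next
    case False
    then have deg: "\<And>v. v \<in> verts G \<Longrightarrow> k \<le> card (edge_cut G {v})" by force
    have "2 \<le> ?n" using less.prems by linarith
    then obtain S where S: "S \<noteq> {}" "S \<subset> verts G" "card (edge_cut G S) < k"
      using exists_small_cut[OF sg free] by blast
    let ?T = "verts G - S"
    have cards: "1 \<le> card S" "1 \<le> card ?T" "card S + card ?T = ?n"
      using card_split[OF fin, of S] S by (auto simp: Int_absorb1 psubset_imp_subset)
    have cutT: "card (edge_cut G ?T) < k" using S cut_compl[OF sg, of S] by simp
    have big: "k + 1 \<le> card X" if "X \<subseteq> verts G" "1 \<le> card X" "card (edge_cut G X) < k" for X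
    proof (rule ccontr)
      assume "\<not> k + 1 \<le> card X"
      then have "k \<le> card (edge_cut G X)"
        using that deg by (intro card_cut_small_set[OF sg, of X]) auto
      then show False using that(3) by simp
    qed
    have k1: "card (edge_cut G S) = k - 1"
      using saturated_cut_card[OF less.prems(2) _ S] less.prems(3) by simp
    have S_sub: "S \<subseteq> verts G" using S by blast
    have IHS: "(k - 1) * (card S - 1) \<le> card (edges (induced G S)) + card S div (k + 1) * ?c"
      using S_sub S cards big[of S] by (intro IH) auto
    have IHT: "(k - 1) * (card ?T - 1) \<le> card (edges (induced G ?T)) + card ?T div (k + 1) * ?c"
      using cutT cards big[of ?T] by (intro IH) auto
    have "(k - 1) * (?n - 1) = (k - 1) * ((card S - 1) + (card ?T - 1) + 1)"
      using cards by (intro arg_cong2[where f = "(*)"]) auto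
    also have "\<dots> = (k - 1) * (card S - 1) + (k - 1) * (card ?T - 1) + (k - 1)"
      by (simp add: algebra_simps)
    also have "\<dots> \<le> card (edges (induced G S)) + card (edges (induced G ?T)) + (k - 1)
        + (card S div (k + 1) + card ?T div (k + 1)) * ?c"
      using IHS IHT by (simp add: add_mult_distrib)
    also have "\<dots> = card (edges G) + (card S div (k + 1) + card ?T div (k + 1)) * ?c"
      using card_edges_split[OF sg, of S] S k1 by auto
    also have "\<dots> \<le> card (edges G) + ?n div (k + 1) * ?c"
      using div_add1_eq[of "card S" "card ?T" "k + 1"] cards(3)
      by (intro add_left_mono mult_le_mono1) simp
    finally show ?thesis .
  qed
qed

section \<open>Small connectivity: edgeless graphs, stars and trees\<close>

lemma saturated_edgeless:
  assumes "finite V"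
  shows "saturated (edge_connected_family 1) (V, {})"
proof (rule saturated_of_max_edges)
  show "\<not> has_ec 1 (V, {})"
  proof
    assume "has_ec 1 (V, {})"
    then obtain H where H: "subgraph H (V, {})" "edge_connected 1 H" unfolding has_ec_def by blast
    then have "verts H \<noteq> {}" unfolding edge_connected_def by auto
    then show False using edge_connected_degree[OF H(2,1)] by (auto simp: edge_cut_def)
  qed
qed (use assms in \<open>auto simp: simple_graph_def\<close>)

lemma saturated_star:
  assumes "finite V" "c \<notin> V"
  shows "saturated (edge_connected_family 2) (insert c V, cross {c} V)"
proof (rule saturated_of_max_edges)
  let ?G = "(insert c V, cross {c} V)"
  show "simple_graph ?G"
    unfolding simple_graph_iff
  proof (intro conjI ballI)
    fix e assume "e \<in> edges ?G"
    then obtain v where "v \<in> V" "e = {c, v}" by (auto simp: cross_iff)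
    then show "\<exists>x y. e = {x, y} \<and> x \<in> verts ?G \<and> y \<in> verts ?G \<and> x \<noteq> y"
      using assms(2) by (intro exI[of _ c] exI[of _ v]) auto
  qed (use assms(1) in simp)
  show "\<not> has_ec 2 ?G"
  proof
    assume "has_ec 2 ?G"
    then obtain H where H: "subgraph H ?G" "edge_connected 2 H" unfolding has_ec_def by blast
    have "\<not> verts H \<subseteq> {c}"
      using H(2) card_mono[of "{c}" "verts H"] unfolding edge_connected_def by auto
    then obtain v where v: "v \<in> verts H" "v \<noteq> c" by blast
    then have "2 \<le> card (edge_cut ?G {v})" using edge_connected_degree[OF H(2,1)] by blast
    moreover have "edge_cut ?G {v} \<subseteq> {{c, v}}"
      using v(2) by (auto simp: edge_cut_def cross_iff)
    ultimately show False using card_mono[of "{{c, v}}" "edge_cut ?G {v}"] by simp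
  qed
  show "card (edges ?G) = (2 - 1) * (card (verts ?G) - 1)"
    using assms by (simp add: card_cross)
qed

text \<open>The edges from each vertex other than a root to a neighbour nearer to the root are distinct.\<close>
lemma card_verts_le_of_connected:
  assumes sg: "simple_graph G" and con: "connected_graph G"
  shows "card (verts G) \<le> card (edges G) + 1"
proof -
  obtain r where r: "r \<in> verts G" using con unfolding connected_graph_def by auto
  let ?R = "{(a, b). {a, b} \<in> edges G}"
  \<comment> \<open>distance from the root\<close>
  define d where "d v = (LEAST m. (r, v) \<in> ?R ^^ m)" for v
  have ex: "\<exists>p. {p, v} \<in> edges G \<and> d p < d v" if v: "v \<in> verts G - {r}" for v
  proof -
    have "(r, v) \<in> ?R\<^sup>*" using con r v unfolding connected_graph_def by blast
    then obtain m where "(r, v) \<in> ?R ^^ m" using rtrancl_imp_relpow by blast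
    then have dv: "(r, v) \<in> ?R ^^ d v" unfolding d_def by (rule LeastI)
    have "d v \<noteq> 0"
    proof
      assume "d v = 0"
      then show False using dv v by simp
    qed
    then obtain i where i: "d v = Suc i" by (cases "d v") auto
    then obtain p where p: "(r, p) \<in> ?R ^^ i" "(p, v) \<in> ?R" using dv relpow_Suc_E by metis
    have "d p \<le> i" unfolding d_def using p(1) by (rule Least_le)
    then show ?thesis using p(2) i by auto
  qed
  then obtain p where p: "\<And>v. v \<in> verts G - {r} \<Longrightarrow> {p v, v} \<in> edges G \<and> d (p v) < d v" by metis
  have "inj_on (\<lambda>v. {p v, v}) (verts G - {r})"
  proof (rule inj_onI)
    fix v w assume vw: "v \<in> verts G - {r}" "w \<in> verts G - {r}" "{p v, v} = {p w, w}"
    show "v = w"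
      using vw(3) p[OF vw(1)] p[OF vw(2)] by (auto simp: doubleton_eq_iff)
  qed
  then have "card (verts G - {r}) \<le> card (edges G)"
    using p finite_edges[OF sg] by (intro card_inj_on_le[of "\<lambda>v. {p v, v}"]) auto
  then show ?thesis using r simple_finite[OF sg] by simp
qed

text \<open>An edge of a 2-edge-connected graph is not a bridge, so a path between its ends that
  avoids it closes up to a cycle.\<close>
lemma acyclic_not_has_ec_2:
  assumes acyc: "\<nexists>xs. is_cycle G xs"
  shows "\<not> has_ec 2 G"
proof
  assume "has_ec 2 G"
  then obtain H where H: "subgraph H G" "edge_connected 2 H" unfolding has_ec_def by blast
  have sgH: "simple_graph H" using H(2) unfolding edge_connected_def by blast
  have "verts H \<noteq> {}" using H(2) unfolding edge_connected_def by auto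
  then obtain v where "v \<in> verts H" by blast
  moreover have "subgraph H H" using sgH unfolding subgraph_def by simp
  ultimately have "2 \<le> card (edge_cut H {v})" using edge_connected_degree[OF H(2)] by blast
  then have "edge_cut H {v} \<noteq> {}" by auto
  then obtain e where e: "e \<in> edges H" unfolding edge_cut_def by auto
  obtain x y where xy: "e = {x, y}" "x \<in> verts H" "y \<in> verts H" "x \<noteq> y"
    using simple_edgeE[OF sgH e] .
  define r where "r a b \<longleftrightarrow> {a, b} \<in> edges H - {e}" for a b
  have "connected_graph (delete_edges H {e})"
    using H(2) e unfolding edge_connected_def by simp
  then have "(x, y) \<in> {(a, b). r a b}\<^sup>*"
    using xy(2,3) unfolding connected_graph_def delete_edges_def r_def by simp
  then have "r\<^sup>*\<^sup>* x y" by (simp add: rtranclp_rtrancl_eq)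
  then obtain ys where "rtrancl_path r x ys y" using rtranclp_eq_rtrancl_path by metis
  then obtain xs where path: "rtrancl_path r x xs y" and dist: "distinct (x # xs)"
    by (rule rtrancl_path_distinct)
  have ne: "xs \<noteq> []" using path xy(4) by (auto elim: rtrancl_path.cases)
  have last: "xs ! (length xs - 1) = y"
    using rtrancl_path_last[OF path ne] ne by (simp add: last_conv_nth)
  have nth: "{(x # xs) ! i, xs ! i} \<in> edges H - {e}" if "i < length xs" for i
    using rtrancl_path_nth[OF path that] unfolding r_def .
  have "length xs \<noteq> 1"
    using nth[of 0] last xy(1) by (intro notI) auto
  then have len: "2 \<le> length xs" using ne by (cases xs) (auto simp: Suc_le_eq)
  have sub: "verts H \<subseteq> verts G" "edges H \<subseteq> edges G" using H(1) unfolding subgraph_def by auto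
  have "is_cycle G (x # xs)"
    unfolding is_cycle_def
  proof (intro conjI allI impI)
    show "3 \<le> length (x # xs)" using len by simp
    show "set (x # xs) \<subseteq> verts G"
    proof
      fix z assume "z \<in> set (x # xs)"
      then consider "z = x" | i where "i < length xs" "z = xs ! i" by (auto simp: in_set_conv_nth)
      then show "z \<in> verts G"
      proof cases
        case 1
        then show ?thesis using xy sub by auto
      next
        case 2
        then show ?thesis using edge_subset[OF sgH, of "{(x # xs) ! i, xs ! i}"] nth[of i] sub by auto
      qed
    qed
    fix i assume i: "i < length (x # xs)"
    show "{(x # xs) ! i, (x # xs) ! (Suc i mod length (x # xs))} \<in> edges G"
    proof (cases "i < length xs")
      case True
      then show ?thesis using nth[OF True] sub by auto
    next
      case False
      then have i: "i = length xs" using i by simp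
      have "(x # xs) ! length xs = y" using last ne by (simp add: nth_Cons')
      then show ?thesis using i e xy(1) sub by (auto simp: insert_commute)
    qed
  qed (rule dist)
  then show False using acyc by blast
qed

lemma saturated_tree:
  assumes "tree T"
  shows "saturated (edge_connected_family 2) T" "card (edges T) = card (verts T) - 1"
proof -
  have sg: "simple_graph T" and con: "connected_graph T" and free: "\<not> has_ec 2 T"
    using assms acyclic_not_has_ec_2[of T] unfolding tree_def by blast+
  have "1 \<le> card (verts T)"
    using con simple_finite[OF sg] by (simp add: connected_graph_def Suc_le_eq card_gt_0_iff)
  then show c: "card (edges T) = card (verts T) - 1"
    using card_edges_le_of_not_has_ec[OF sg free] card_verts_le_of_connected[OF sg con] by simp
  show "saturated (edge_connected_family 2) T"
    by (rule saturated_of_max_edges[OF sg free]) (simp add: c)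
qed

section \<open>Chains of almost complete graphs\<close>

definition block :: "nat \<Rightarrow> nat \<Rightarrow> nat set" where
  "block k i = u_vertex k i ` {1..k+1}"

definition links :: "nat \<Rightarrow> nat \<Rightarrow> nat set set" where
  "links k i = (\<lambda>j. {u_vertex k i j, u_vertex k (i+1) j}) ` ({1..k+1} - {2, k})"

text \<open>The stretch from block \<open>a\<close> to block \<open>b\<close> of the graph \<open>F\<^sub>t\<close>.\<close>

definition chain_graph :: "nat \<Rightarrow> nat \<Rightarrow> nat \<Rightarrow> nat graph" where
  "chain_graph k a b = (\<Union>i\<in>{a..b}. block k i,
     (\<Union>i\<in>{a..b}. edges (H_graph k i)) \<union> (\<Union>i\<in>{a..<b}. links k i))"

lemma verts_chain: "verts (chain_graph k a b) = (\<Union>i\<in>{a..b}. block k i)"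
  and edges_chain: "edges (chain_graph k a b) =
    (\<Union>i\<in>{a..b}. edges (H_graph k i)) \<union> (\<Union>i\<in>{a..<b}. links k i)"
  by (simp_all add: chain_graph_def)

lemma u_vertex_eq_iff:
  assumes "1 \<le> i" "1 \<le> i'" "j \<in> {1..k+1}" "j' \<in> {1..k+1}"
  shows "u_vertex k i j = u_vertex k i' j' \<longleftrightarrow> i = i' \<and> j = j'"
proof
  have dm: "(u_vertex k i j - 1) div (k + 1) = i - 1 \<and> (u_vertex k i j - 1) mod (k + 1) = j - 1"
    if "1 \<le> i" "j \<in> {1..k+1}" for i j
  proof -
    have "u_vertex k i j - 1 = (j - 1) + (i - 1) * (k + 1)" "j - 1 < k + 1"
      using that by (auto simp: u_vertex_def)
    then show ?thesis by (metis add.commute add_cancel_left_left div_less div_mult_self3 mod_less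
        mod_mult_self3 add_gr_0 less_one not_less_zero less_nat_zero_code)
  qed
  assume "u_vertex k i j = u_vertex k i' j'"
  then have "i - 1 = i' - 1" "j - 1 = j' - 1" using dm[of i j] dm[of i' j'] assms by metis+
  then show "i = i' \<and> j = j'" using assms by auto
qed simp

lemma finite_block: "finite (block k i)" unfolding block_def by simp

lemma card_block: "1 \<le> i \<Longrightarrow> card (block k i) = k + 1"
  unfolding block_def by (subst card_image) (auto simp: inj_on_def u_vertex_eq_iff)

lemma block_disjoint: "1 \<le> i \<Longrightarrow> 1 \<le> i' \<Longrightarrow> i \<noteq> i' \<Longrightarrow> block k i \<inter> block k i' = {}"
  unfolding block_def by (auto simp: u_vertex_eq_iff)

lemma u_vertex_in_block: "j \<in> {1..k+1} \<Longrightarrow> u_vertex k i j \<in> block k i"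
  unfolding block_def by simp

lemma verts_H: "verts (H_graph k i) = block k i"
  unfolding H_graph_def block_def delete_edges_def complete_graph_def by simp

lemma edges_H: "edges (H_graph k i) =
    edges (complete_graph (block k i)) - {{u_vertex k i 1, u_vertex k i (k+1)}}"
  unfolding H_graph_def block_def delete_edges_def by simp

lemma simple_H: "simple_graph (H_graph k i)"
  unfolding simple_graph_def edges_H verts_H using finite_block by auto

text \<open>A split of \<open>k + 1\<close> vertices separates at least \<open>k\<close> pairs. The missing edge of the block costs
  one of them, and only if its ends are separated.\<close>
lemma H_edge_cut_card:
  assumes "1 \<le> i" "block k i \<inter> S \<noteq> {}" "block k i - S \<noteq> {}"
  shows "k - 1 \<le> card (edge_cut (H_graph k i) S)"
    and "(u_vertex k i 1 \<in> S \<longleftrightarrow> u_vertex k i (k+1) \<in> S) \<Longrightarrow> k \<le> card (edge_cut (H_graph k i) S)"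
proof -
  let ?B = "block k i" and ?e = "{u_vertex k i 1, u_vertex k i (k+1)}"
  let ?X = "cross (?B \<inter> S) (?B - S)"
  have cut: "edge_cut (H_graph k i) S = ?X - {?e}"
    using cut_complete[of ?B S] unfolding edge_cut_def edges_H by blast
  have k: "k \<le> card ?X"
    using card_split[OF finite_block assms(2,3)] pred_le_mult[of "card (?B \<inter> S)" "card (?B - S)"]
      card_block[OF assms(1), of k] by (simp add: card_cross Int_Diff_disjoint)
  show "k - 1 \<le> card (edge_cut (H_graph k i) S)"
    using k diff_card_le_card_Diff[of "{?e}" ?X] unfolding cut by simp
  assume "u_vertex k i 1 \<in> S \<longleftrightarrow> u_vertex k i (k+1) \<in> S"
  then have "?e \<notin> ?X" unfolding cross_iff by (auto simp: doubleton_eq_iff)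
  then show "k \<le> card (edge_cut (H_graph k i) S)" using k unfolding cut by simp
qed

lemma card_links:
  assumes "3 \<le> k" "1 \<le> i" shows "card (links k i) = k - 1"
proof -
  have "inj_on (\<lambda>j. {u_vertex k i j, u_vertex k (i+1) j}) ({1..k+1} - {2, k})"
    using assms by (intro inj_onI) (auto simp: doubleton_eq_iff u_vertex_eq_iff)
  then have "card (links k i) = card ({1..k+1} - {2, k})" unfolding links_def by (rule card_image)
  also have "\<dots> = card {1..k+1} - card {2, k}" using assms by (intro card_Diff_subset) auto
  finally show ?thesis using assms by simp
qed

lemma links_subset_cross: "links k i \<subseteq> cross (block k i) (block k (i+1))"
  unfolding links_def using u_vertex_in_block by (fastforce simp: cross_iff)

lemma simple_chain:
  assumes "1 \<le> a" shows "simple_graph (chain_graph k a b)"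
  unfolding simple_graph_iff
proof (intro conjI ballI)
  let ?V = "verts (chain_graph k a b)"
  show "finite ?V" by (simp add: chain_graph_def finite_block)
  fix e assume "e \<in> edges (chain_graph k a b)"
  then consider i where "i \<in> {a..b}" "e \<in> edges (H_graph k i)"
    | i where "i \<in> {a..<b}" "e \<in> links k i" unfolding chain_graph_def by auto
  then show "\<exists>x y. e = {x, y} \<and> x \<in> ?V \<and> y \<in> ?V \<and> x \<noteq> y"
  proof cases
    case 1
    then show ?thesis using simple_edgeE[OF simple_H 1(2)]
      unfolding verts_H chain_graph_def by (metis UN_I fst_conv)
  next
    case 2
    then obtain x y where xy: "x \<in> block k i" "y \<in> block k (i+1)" "e = {x, y}"
      using links_subset_cross by (meson cross_iff subsetD)
    have "x \<noteq> y" using xy block_disjoint[of i "i+1" k] assms 2 by auto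
    moreover have "x \<in> ?V" "y \<in> ?V"
      using xy 2 by (auto simp: chain_graph_def intro: bexI[of _ i] bexI[of _ "i+1"])
    ultimately show ?thesis using xy by blast
  qed
qed

lemma exists_change:
  assumes "a \<le> (b::nat)" "P a \<noteq> P b"
  shows "\<exists>i\<in>{a..<b}. P i \<noteq> P (i+1)"
  using assms
proof (induction rule: dec_induct)
  case (step n)
  show ?case
  proof (cases "P a = P n")
    case True
    then show ?thesis using step by (intro bexI[of _ n]) auto
  next
    case False
    then show ?thesis using step by fastforce
  qed
qed simp

text \<open>A small cut cannot split a block \<open>i\<close>: it would use \<open>k - 1\<close> edges there and separate \<open>u\<^bsub>i,1\<^esub>\<close>
  from \<open>u\<^bsub>i,k+1\<^esub>\<close>, hence, having no edge left for the links to a neighbouring block, separate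
  the corresponding two vertices of that block too, which costs another \<open>k - 1\<close> edges. So the cut
  consists of whole blocks, and every change of side along the chain costs a full set of \<open>k - 1\<close>
  links. As \<open>2 * (k - 1) \<ge> k\<close>, there is exactly one change.\<close>
lemma chain_small_cut:
  assumes k: "3 \<le> k" and ab: "1 \<le> a" "a < b"
    and C: "card (edge_cut (chain_graph k a b) S) < k"
    and S: "verts (chain_graph k a b) \<inter> S \<noteq> {}" "verts (chain_graph k a b) - S \<noteq> {}"
  shows "k - 1 \<le> card (edge_cut (chain_graph k a b) S)"
    and "block k a \<subseteq> S \<and> block k b \<inter> S = {} \<or> block k a \<inter> S = {} \<and> block k b \<subseteq> S"
proof -
  let ?C = "edge_cut (chain_graph k a b) S"
  have fin: "finite ?C" using finite_cut simple_chain ab by blast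
  have two: "card X + card Y < k" if "X \<subseteq> ?C" "Y \<subseteq> ?C" "X \<inter> Y = {}" for X Y
  proof -
    have "card X + card Y = card (X \<union> Y)"
      using that fin finite_subset by (metis card_Un_disjoint)
    also have "\<dots> \<le> card ?C" using that fin by (intro card_mono) auto
    finally show ?thesis using C by simp
  qed
  have H_in: "edge_cut (H_graph k i) S \<subseteq> ?C" if "i \<in> {a..b}" for i
    using that by (intro cut_mono) (auto simp: chain_graph_def)
  have links_in: "e \<in> ?C" if "i \<in> {a..<b}" "e \<in> links k i" "e \<inter> S \<noteq> {}" "\<not> e \<subseteq> S" for i e
    using that by (auto simp: edge_cut_def chain_graph_def)
  have H_cut_sub: "e \<subseteq> block k i" if "e \<in> edge_cut (H_graph k i) S" for e i
    using that edge_subset[OF simple_H, of e k i] by (simp add: edge_cut_def verts_H)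
  have split_ends: "u_vertex k i 1 \<in> S \<longleftrightarrow> u_vertex k i (k+1) \<notin> S"
    if "i \<in> {a..b}" "block k i \<inter> S \<noteq> {}" "block k i - S \<noteq> {}" for i
  proof -
    have "card (edge_cut (H_graph k i) S) < k"
      using card_mono[OF fin H_in[OF that(1)]] C by simp
    then show ?thesis using H_edge_cut_card(2)[of i k S] that ab by fastforce
  qed
  have nosplit: "block k i \<subseteq> S \<or> block k i \<inter> S = {}" if i: "i \<in> {a..b}" for i
  proof (rule ccontr)
    assume "\<not> ?thesis"
    then have si: "block k i \<inter> S \<noteq> {}" "block k i - S \<noteq> {}" by auto
    have ci: "k - 1 \<le> card (edge_cut (H_graph k i) S)"
      using H_edge_cut_card(1)[of i k S] si i ab by simp
    (* q is a block next to i, and m the smaller of the two indices *)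
    obtain m q where mq: "m \<in> {a..<b}" "i = m \<and> q = m + 1 \<or> i = m + 1 \<and> q = m"
    proof (cases "i < b")
      case True
      then show thesis using that[of i "i + 1"] i by simp
    next
      case False
      then show thesis using that[of "i - 1" "i - 1"] i ab by simp
    qed
    have q: "q \<in> {a..b}" "q \<noteq> i" using mq by auto
    have same: "u_vertex k m j \<in> S \<longleftrightarrow> u_vertex k (m+1) j \<in> S" if j: "j \<in> {1..k+1} - {2, k}" for j
    proof (rule ccontr)
      let ?e = "{u_vertex k m j, u_vertex k (m+1) j}"
      assume "\<not> ?thesis"
      then have "?e \<in> ?C" using j by (intro links_in[OF mq(1)]) (auto simp: links_def)
      moreover have "?e \<notin> edge_cut (H_graph k i) S"
      proof
        assume "?e \<in> edge_cut (H_graph k i) S"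
        then have "?e \<subseteq> block k i" by (rule H_cut_sub)
        moreover have "u_vertex k q j \<in> ?e" "u_vertex k q j \<in> block k q"
          using mq j by (auto intro: u_vertex_in_block)
        ultimately show False using block_disjoint[of i q k] q i ab by auto
      qed
      ultimately show False using two[OF H_in[OF i], of "{?e}"] ci k by simp
    qed
    have "u_vertex k q 1 \<in> S \<longleftrightarrow> u_vertex k q (k+1) \<notin> S"
      using same[of 1] same[of "k+1"] split_ends[OF i si] mq k by auto
    moreover have "u_vertex k q 1 \<in> block k q" "u_vertex k q (k+1) \<in> block k q"
      by (simp_all add: u_vertex_in_block)
    ultimately have "block k q \<inter> S \<noteq> {}" "block k q - S \<noteq> {}" by auto
    then have cq: "k - 1 \<le> card (edge_cut (H_graph k q) S)"
      using H_edge_cut_card(1)[of q k S] q ab by simp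
    have "edge_cut (H_graph k i) S \<inter> edge_cut (H_graph k q) S = {}"
    proof (rule equals0I)
      fix e assume "e \<in> edge_cut (H_graph k i) S \<inter> edge_cut (H_graph k q) S"
      then have "e \<subseteq> block k i \<inter> block k q" "e \<noteq> {}"
        using H_cut_sub by (auto simp: edge_cut_def)
      then show False using block_disjoint[of i q k] q i ab by auto
    qed
    then show False using two[OF H_in[OF i] H_in[OF q(1)]] ci cq k by simp
  qed
  define P where "P i \<longleftrightarrow> block k i \<subseteq> S" for i
  have change: "links k i \<subseteq> ?C" if i: "i \<in> {a..<b}" "P i \<noteq> P (i+1)" for i
  proof
    fix e assume e: "e \<in> links k i"
    then obtain x y where "x \<in> block k i" "y \<in> block k (i+1)" "e = {x, y}"
      using links_subset_cross by (meson cross_iff subsetD)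
    then show "e \<in> ?C"
      using nosplit[of i] nosplit[of "i+1"] i unfolding P_def
      by (intro links_in[OF i(1) e]) auto
  qed
  have unique: "i = i'" if "i \<in> {a..<b}" "P i \<noteq> P (i+1)" "i' \<in> {a..<b}" "P i' \<noteq> P (i'+1)" for i i'
  proof (rule ccontr)
    assume ne: "i \<noteq> i'"
    have "links k i \<inter> links k i' = {}"
    proof (rule equals0I)
      fix e assume "e \<in> links k i \<inter> links k i'"
      then have e: "e \<in> cross (block k i) (block k (i+1))" "e \<in> cross (block k i') (block k (i'+1))"
        using links_subset_cross by blast+
      obtain x y where "x \<in> block k i" "y \<in> block k (i+1)" "e = {x, y}"
        using e(1) unfolding cross_iff by blast
      moreover obtain x' y' where "x' \<in> block k i'" "y' \<in> block k (i'+1)" "e = {x', y'}"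
        using e(2) unfolding cross_iff by blast
      ultimately show False
        using block_disjoint[of i i' k] block_disjoint[of i "i'+1" k]
          block_disjoint[of "i+1" i' k] block_disjoint[of "i+1" "i'+1" k] ne that ab
        by (cases "i = i' + 1") (auto simp: doubleton_eq_iff)
    qed
    then show False
      using two[OF change[OF that(1,2)] change[OF that(3,4)]] card_links[OF k] that ab k by simp
  qed
  obtain x i where x: "x \<in> S" "i \<in> {a..b}" "x \<in> block k i" 
    using S(1) unfolding verts_chain by blast
  obtain y i' where y: "y \<notin> S" "i' \<in> {a..b}" "y \<in> block k i'" 
    using S(2) unfolding verts_chain by blast
  have "P i" "\<not> P i'" using x y nosplit[of i] unfolding P_def by auto
  then obtain m where m: "m \<in> {a..b}" "P a \<noteq> P m" using x(2) y(2) by metis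
  then have "a \<le> m" "m \<le> b" by simp_all
  obtain c where c: "c \<in> {a..<m}" "P c \<noteq> P (c+1)"
    using exists_change[of a m P] \<open>a \<le> m\<close> m(2) by blast
  \<comment> \<open>if \<open>P a = P b\<close>, the side changes before \<open>m\<close> and again after it\<close>
  have ends: "P a \<noteq> P b"
  proof
    assume "P a = P b"
    then have "P m \<noteq> P b" using m(2) by simp
    then obtain c' where c': "c' \<in> {m..<b}" "P c' \<noteq> P (c'+1)"
      using exists_change[of m b P] \<open>m \<le> b\<close> by blast
    then have "c = c'" using unique[of c c'] c m by auto
    then show False using c c' by simp
  qed
  show "block k a \<subseteq> S \<and> block k b \<inter> S = {} \<or> block k a \<inter> S = {} \<and> block k b \<subseteq> S"
    using ends nosplit[of a] nosplit[of b] ab unfolding P_def by auto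
  have "card (links k c) \<le> card ?C" using change[of c] c m by (intro card_mono fin) auto
  then show "k - 1 \<le> card ?C" using card_links[OF k, of c] c ab by simp
qed

lemma simple_add_pair:
  "simple_graph G \<Longrightarrow> x \<in> verts G \<Longrightarrow> y \<in> verts G \<Longrightarrow> x \<noteq> y \<Longrightarrow> simple_graph (add_edge G {x, y})"
  unfolding simple_graph_def add_edge_def complete_graph_def by auto

text \<open>The new edge crosses every cut of the chain that has fewer than \<open>k\<close> edges.\<close>
lemma edge_connected_chain_add_edge:
  assumes k: "3 \<le> k" and ab: "1 \<le> a" "a < b" and xy: "x \<in> block k a" "y \<in> block k b"
    and new: "{x, y} \<notin> edges (chain_graph k a b)"
  shows "edge_connected k (add_edge (chain_graph k a b) {x, y})"
  unfolding edge_connected_iff_cut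
proof (intro conjI allI impI; (elim conjE)?)
  let ?G = "chain_graph k a b" and ?e = "{x, y}"
  have V: "x \<in> verts ?G" "y \<in> verts ?G" using xy ab by (force simp: chain_graph_def)+
  have ne: "x \<noteq> y" using xy ab block_disjoint[of a b k] by auto
  have sg: "simple_graph ?G" using simple_chain ab by simp
  show sg': "simple_graph (add_edge ?G ?e)" using simple_add_pair[OF sg V ne] .
  have "card {x, y} \<le> card (verts ?G)" using V simple_finite[OF sg] by (intro card_mono) auto
  then show "2 \<le> card (verts (add_edge ?G ?e))" using ne by (simp add: add_edge_def)
  fix S assume S: "verts (add_edge ?G ?e) \<inter> S \<noteq> {}" "verts (add_edge ?G ?e) - S \<noteq> {}"
  then have S': "verts ?G \<inter> S \<noteq> {}" "verts ?G - S \<noteq> {}" by (auto simp: add_edge_def)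
  have sub: "edge_cut ?G S \<subseteq> edge_cut (add_edge ?G ?e) S"
    by (intro cut_mono) (auto simp: add_edge_def)
  show "k \<le> card (edge_cut (add_edge ?G ?e) S)"
  proof (cases "card (edge_cut ?G S) < k")
    case True
    note c = chain_small_cut[OF k ab True S']
    have "insert ?e (edge_cut ?G S) \<subseteq> edge_cut (add_edge ?G ?e) S"
      using sub c(2) xy by (auto simp: edge_cut_def add_edge_def)
    then have "card (insert ?e (edge_cut ?G S)) \<le> card (edge_cut (add_edge ?G ?e) S)"
      using finite_cut[OF sg'] by (intro card_mono) auto
    moreover have "?e \<notin> edge_cut ?G S" using new by (simp add: edge_cut_def)
    ultimately show ?thesis using c(1) finite_cut[OF sg] k by simp
  next
    case False
    then show ?thesis using card_mono[OF finite_cut[OF sg'] sub] by simp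
  qed
qed

text \<open>The vertex \<open>w\<close> has degree \<open>k\<close>, so it cannot be cut off alone; and it has neighbours in the
  first and in the last block, so a cut separating these blocks also cuts an edge at \<open>w\<close>.\<close>
lemma edge_connected_chain_add_vertex:
  assumes k: "3 \<le> k" and ab: "1 \<le> a" "a < b" and x: "x \<in> block k a"
    and N: "N \<subseteq> block k b" "card N = k - 1" and w: "w \<notin> verts (chain_graph k a b)"
  shows "edge_connected k (insert w (verts (chain_graph k a b)),
    edges (chain_graph k a b) \<union> cross {w} (insert x N))" (is "edge_connected k ?G'")
  unfolding edge_connected_iff_cut
proof (intro conjI allI impI; (elim conjE)?)
  let ?G = "chain_graph k a b" and ?star = "cross {w} (insert x N)"
  have sg: "simple_graph ?G" using simple_chain ab by simp
  have xN: "x \<notin> N" using x N(1) block_disjoint[of a b k] ab by auto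
  have finN: "finite N" using N(1) finite_block finite_subset by blast
  have V: "insert x N \<subseteq> verts ?G" using x N(1) ab by (force simp: chain_graph_def)
  have wN: "w \<notin> insert x N" using V w by blast
  have star: "card ?star = k" using N(2) xN finN wN k by (simp add: card_cross)
  show sg': "simple_graph ?G'"
    unfolding simple_graph_iff
  proof (intro conjI ballI)
    show "finite (verts ?G')" using simple_finite[OF sg] by simp
    fix e assume "e \<in> edges ?G'"
    then consider "e \<in> edges ?G" | "e \<in> ?star" by auto
    then show "\<exists>y z. e = {y, z} \<and> y \<in> verts ?G' \<and> z \<in> verts ?G' \<and> y \<noteq> z"
    proof cases
      case 1
      then show ?thesis using simple_edgeE[OF sg 1] by (metis fst_conv insertCI)
    next
      case 2
      then obtain z where z: "z \<in> insert x N" "e = {w, z}" by (auto simp: cross_iff)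
      then have "z \<in> verts ?G'" "w \<noteq> z" using V wN by auto
      then show ?thesis using z by (intro exI[of _ w] exI[of _ z]) simp
    qed
  qed
  have "card {w, x} \<le> card (verts ?G')"
    using V simple_finite[OF sg] by (intro card_mono) auto
  then show "2 \<le> card (verts ?G')" using wN by (simp add: card_insert_if split: if_splits)
  fix S assume S: "verts ?G' \<inter> S \<noteq> {}" "verts ?G' - S \<noteq> {}"
  have sub: "edge_cut ?G S \<subseteq> edge_cut ?G' S" by (intro cut_mono) auto
  consider "verts ?G \<inter> S = {}" | "verts ?G \<subseteq> S"
    | "verts ?G \<inter> S \<noteq> {}" "verts ?G - S \<noteq> {}" by blast
  then show "k \<le> card (edge_cut ?G' S)"
  proof cases
    case 1
    then have "w \<in> S" using S(1) by auto
    moreover have "v \<notin> S" if "v \<in> insert x N" for v using 1 V that by blast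
    ultimately have "?star \<subseteq> edge_cut ?G' S" by (auto simp: edge_cut_def cross_iff)
    then show ?thesis using card_mono[OF finite_cut[OF sg']] star by metis
  next
    case 2
    then have "w \<notin> S" using S(2) by auto
    moreover have "v \<in> S" if "v \<in> insert x N" for v using 2 V that by blast
    ultimately have "?star \<subseteq> edge_cut ?G' S" by (auto simp: edge_cut_def cross_iff)
    then show ?thesis using card_mono[OF finite_cut[OF sg']] star by metis
  next
    case 3
    show ?thesis
    proof (cases "card (edge_cut ?G S) < k")
      case True
      note c = chain_small_cut[OF k ab True 3]
      have "N \<noteq> {}" using N(2) k by auto
      then obtain z where z: "z \<in> N" by blast
      then have "(z \<in> S) \<noteq> (x \<in> S)" using c(2) x N(1) by auto
      then obtain v where v: "v \<in> insert x N" "(v \<in> S) \<noteq> (w \<in> S)" using z by auto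
      then have "insert {w, v} (edge_cut ?G S) \<subseteq> edge_cut ?G' S"
        using sub by (auto simp: edge_cut_def cross_iff)
      then have "card (insert {w, v} (edge_cut ?G S)) \<le> card (edge_cut ?G' S)"
        using finite_cut[OF sg'] by (intro card_mono) auto
      moreover have "{w, v} \<notin> edge_cut ?G S"
        using edge_subset[OF sg, of "{w, v}"] w by (auto simp: edge_cut_def)
      ultimately show ?thesis using c(1) finite_cut[OF sg] k by simp
    next
      case False
      then show ?thesis using card_mono[OF finite_cut[OF sg'] sub] by simp
    qed
  qed
qed

section \<open>The extremal graphs for k at least 3\<close>

lemma has_ec_of_clique:
  assumes "simple_graph G" "B \<subseteq> verts G" "card B = k + 1" "1 \<le> k"
    and "\<And>x y. x \<in> B \<Longrightarrow> y \<in> B \<Longrightarrow> x \<noteq> y \<Longrightarrow> {x, y} \<in> edges G"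
  shows "has_ec k G"
proof -
  have "subgraph (complete_graph B) G"
    unfolding subgraph_def
  proof (intro conjI)
    show "simple_graph (complete_graph B)"
      using simple_complete finite_subset[OF assms(2) simple_finite[OF assms(1)]] by blast
  qed (use assms in \<open>auto simp: complete_graph_def\<close>)
  then show ?thesis using edge_connected_complete[OF assms(3,4)] unfolding has_ec_def by blast
qed

lemma saturated_singleton: "1 \<le> k \<Longrightarrow> saturated (edge_connected_family k) ({v}, {})"
proof -
  assume "1 \<le> k"
  moreover have "complete_graph {v} = ({v}, {})" by (auto simp: complete_graph_def)
  ultimately show ?thesis using saturated_complete[of "{v}" k] by simp
qed

lemma H_edge_iff:
  assumes "x \<in> block k i" "y \<in> block k i" "x \<noteq> y"
  shows "{x, y} \<in> edges (H_graph k i) \<longleftrightarrow> {x, y} \<noteq> {u_vertex k i 1, u_vertex k i (k+1)}"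
  using assms unfolding edges_H complete_graph_def by auto

text \<open>The block is a complete graph on \<open>k\<close> vertices joined to \<open>u\<^bsub>i,1\<^esub>\<close> by \<open>k - 1\<close> edges; the only missing
  edge completes a clique on \<open>k + 1\<close> vertices.\<close>
lemma saturated_H:
  assumes k: "3 \<le> k" and i: "1 \<le> i"
  shows "saturated (edge_connected_family k) (H_graph k i)"
    and "card (edges (H_graph k i)) = (k choose 2) + (k - 1)"
proof -
  let ?a = "u_vertex k i 1" and ?z = "u_vertex k i (k+1)"
  let ?B = "block k i - {?a}"
  let ?C = "cross {?a} (?B - {?z})"
  have az: "?a \<in> block k i" "?z \<in> block k i" by (simp_all add: u_vertex_in_block)
  have "?a \<noteq> ?z" using k i by (simp add: u_vertex_eq_iff)
  then have z: "?z \<in> ?B" using az by simp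
  have cB: "card ?B = k" using card_block[OF i, of k] az finite_block by simp
  have cC: "card ?C = k - 1" using cB z finite_block by (simp add: card_cross)
  have edges_eq: "edges (H_graph k i) = {} \<union> edges (complete_graph ?B) \<union> ?C" (is "_ = ?E")
  proof (intro set_eqI iffI)
    fix e assume "e \<in> edges (H_graph k i)"
    then obtain x y where xy: "e = {x, y}" "x \<in> block k i" "y \<in> block k i" "x \<noteq> y" "e \<noteq> {?a, ?z}"
      unfolding edges_H complete_graph_def by auto
    then consider "x = ?a" "y \<in> ?B - {?z}" | "y = ?a" "x \<in> ?B - {?z}" | "x \<in> ?B" "y \<in> ?B"
      by (cases "x = ?a"; cases "y = ?a") auto
    then show "e \<in> ?E"
      using xy by cases (auto simp: cross_iff complete_graph_def)
  next
    fix e assume "e \<in> ?E"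
    then consider x y where "x \<in> ?B" "y \<in> ?B" "x \<noteq> y" "e = {x, y}"
      | y where "y \<in> ?B - {?z}" "e = {?a, y}" by (auto simp: cross_iff complete_graph_def)
    then show "e \<in> edges (H_graph k i)"
      by cases (use az in \<open>auto simp: edges_H complete_graph_def doubleton_eq_iff\<close>)
  qed
  have V: "block k i = {?a} \<union> ?B" using az by auto
  have H: "H_graph k i = ({?a} \<union> ?B, {} \<union> edges (complete_graph ?B) \<union> ?C)"
    using edges_eq verts_H[of k i] V by (metis prod.collapse)
  have sat1: "saturated (edge_connected_family k) ({?a}, {})" using k by (intro saturated_singleton) simp
  have "(?B, edges (complete_graph ?B)) = complete_graph ?B" by (simp add: complete_graph_def)
  then have sat2: "saturated (edge_connected_family k) (?B, edges (complete_graph ?B))"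
    using saturated_complete[of ?B k] cB finite_block by simp
  have new: "has_ec k (add_edge ({?a} \<union> ?B, {} \<union> edges (complete_graph ?B) \<union> ?C) {x, y})"
    if "x \<in> {?a}" "y \<in> ?B" "{x, y} \<notin> ?C" for x y
  proof -
    have xy: "x = ?a" "y = ?z" using that by (auto simp: cross_iff)
    have "has_ec k (add_edge (H_graph k i) {x, y})"
    proof (rule has_ec_of_clique)
      show "simple_graph (add_edge (H_graph k i) {x, y})"
        using simple_add_pair[OF simple_H] az \<open>?a \<noteq> ?z\<close> xy by (simp add: verts_H)
      show "block k i \<subseteq> verts (add_edge (H_graph k i) {x, y})" by (simp add: add_edge_def verts_H)
      show "card (block k i) = k + 1" using card_block[OF i] .
    qed (use k xy H_edge_iff in \<open>auto simp: add_edge_def\<close>)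
    then show ?thesis unfolding H .
  qed
  have dis: "{?a} \<inter> ?B = {}" by simp
  have sub: "?C \<subseteq> cross {?a} ?B" by (auto simp: cross_iff)
  have lt: "card ?C < k" using cC k by simp
  show "saturated (edge_connected_family k) (H_graph k i)"
    unfolding H by (rule saturated_join(1)[OF sat1 sat2 dis sub lt new])
  show "card (edges (H_graph k i)) = (k choose 2) + (k - 1)"
    using saturated_join(2)[OF sat1 sat2 dis sub lt new] card_edges_complete[of ?B] cB cC finite_block
    unfolding edges_eq by simp
qed

lemma subgraph_chain:
  assumes "1 \<le> c" "c \<le> a" "b \<le> d"
  shows "subgraph (chain_graph k a b) (chain_graph k c d)"
proof -
  have "{a..b} \<subseteq> {c..d}" "{a..<b} \<subseteq> {c..<d}" using assms by auto
  then have "verts (chain_graph k a b) \<subseteq> verts (chain_graph k c d)"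
    "edges (chain_graph k a b) \<subseteq> edges (chain_graph k c d)"
    unfolding verts_chain edges_chain by (blast, blast)
  then show ?thesis
    unfolding subgraph_def using simple_chain assms by simp
qed

lemma chain_edge_between_blocks:
  assumes "{x, y} \<in> edges (chain_graph k 1 d)" "x \<in> block k i" "y \<in> block k j" "1 \<le> i" "i < j"
  shows "j = i + 1 \<and> {x, y} \<in> links k i"
proof -
  have at: "m = i" if "x \<in> block k m" "1 \<le> m" for m
    using that assms block_disjoint[of m i k] by auto
  have at': "m = j" if "y \<in> block k m" "1 \<le> m" for m
    using that assms block_disjoint[of m j k] by auto
  consider m where "1 \<le> m" "{x, y} \<in> edges (H_graph k m)" | m where "1 \<le> m" "{x, y} \<in> links k m"
    using assms(1) unfolding chain_graph_def by auto
  then show ?thesis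
  proof cases
    case 1
    then have "m = i" "m = j" using at at' edge_subset[OF simple_H 1(2)] by (auto simp: verts_H)
    then show ?thesis using assms by simp
  next
    case 2
    then obtain p q where pq: "p \<in> block k m" "q \<in> block k (m+1)" "{x, y} = {p, q}"
      using links_subset_cross by (meson cross_iff subsetD)
    then consider "x = p" "y = q" | "x = q" "y = p" by (auto simp: doubleton_eq_iff)
    then show ?thesis
    proof cases
      case 1
      then have "m = i" "m + 1 = j" using at[of m] at'[of "m+1"] pq 2(1) by auto
      then show ?thesis using 2 by simp
    next
      case 2
      then have "m + 1 = i" "m = j" using at[of "m+1"] at'[of m] pq \<open>1 \<le> m\<close> by auto
      then show ?thesis using assms by simp
    qed
  qed
qed

lemma verts_chain_Suc:
  "verts (chain_graph k 1 (Suc t)) = verts (chain_graph k 1 t) \<union> block k (Suc t)"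
  by (auto simp: chain_graph_def atLeastAtMostSuc_conv)

lemma card_verts_chain: "card (verts (chain_graph k 1 t)) = t * (k + 1)"
proof -
  have "card (\<Union>i\<in>{1..t}. block k i) = (\<Sum>i\<in>{1..t}. card (block k i))"
    by (rule card_UN_disjoint) (auto simp: finite_block block_disjoint)
  then show ?thesis by (simp add: chain_graph_def card_block)
qed

text \<open>Appending a block adds a saturated graph and \<open>k - 1\<close> links. An edge from block \<open>i\<close> to the new
  block makes the stretch from \<open>i\<close> on \<open>k\<close>-edge-connected.\<close>
lemma saturated_chain:
  assumes k: "3 \<le> k" and t: "1 \<le> t"
  shows "saturated (edge_connected_family k) (chain_graph k 1 t) \<and>
    card (edges (chain_graph k 1 t)) + t * ((k - 1) choose 2) = (k - 1) * (t * (k + 1) - 1)"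
  using t
proof (induction rule: dec_induct)
  case base
  have "chain_graph k 1 1 = H_graph k 1"
    using verts_H[of k 1] by (simp add: chain_graph_def prod_eq_iff)
  then show ?case
    using saturated_H[OF k, of 1] choose_two_add_pred[of k] k by simp
next
  case (step t)
  let ?F = "chain_graph k 1 t" and ?H = "H_graph k (Suc t)" and ?G = "chain_graph k 1 (Suc t)"
  have F: "saturated (edge_connected_family k) (verts ?F, edges ?F)" using step by simp
  have H: "saturated (edge_connected_family k) (block k (Suc t), edges ?H)"
    using saturated_H(1)[OF k, of "Suc t"] verts_H[of k "Suc t"] by (metis le_add1 plus_1_eq_Suc prod.collapse)
  have dis: "verts ?F \<inter> block k (Suc t) = {}"
    using block_disjoint[of _ "Suc t" k] by (fastforce simp: chain_graph_def)
  have sub: "links k t \<subseteq> cross (verts ?F) (block k (Suc t))"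
  proof -
    have "block k t \<subseteq> verts ?F" using step by (auto simp: chain_graph_def)
    then show ?thesis using links_subset_cross[of k t] by (fastforce simp: cross_iff)
  qed
  have cl: "card (links k t) = k - 1" using card_links[OF k] step by simp
  then have lt: "card (links k t) < k" using k by simp
  have edges_eq: "edges ?G = edges ?F \<union> edges ?H \<union> links k t"
    using step by (auto simp: chain_graph_def atLeastAtMostSuc_conv atLeastLessThanSuc)
  have G: "?G = (verts ?F \<union> block k (Suc t), edges ?F \<union> edges ?H \<union> links k t)"
    using edges_eq verts_chain_Suc by (metis prod.collapse)
  have new: "has_ec k (add_edge (verts ?F \<union> block k (Suc t), edges ?F \<union> edges ?H \<union> links k t) {x, y})"
    if x: "x \<in> verts ?F" and y: "y \<in> block k (Suc t)" and xy: "{x, y} \<notin> links k t" for x y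
  proof -
    obtain i where i: "1 \<le> i" "i \<le> t" "x \<in> block k i" using x by (auto simp: chain_graph_def)
    let ?K = "chain_graph k i (Suc t)"
    have sub: "subgraph ?K ?G" using subgraph_chain i by simp
    have notG: "{x, y} \<notin> edges ?G"
      using chain_edge_between_blocks[of x y k "Suc t" i "Suc t"] i y xy by auto
    then have "{x, y} \<notin> edges ?K" using sub unfolding subgraph_def by blast
    then have ec: "edge_connected k (add_edge ?K {x, y})"
      using edge_connected_chain_add_edge[OF k] i y by simp
    have "x \<noteq> y" using x y dis by auto
    then have "simple_graph (add_edge ?G {x, y})"
      using x y verts_chain_Suc by (intro simple_add_pair simple_chain) auto
    then have "subgraph (add_edge ?K {x, y}) (add_edge ?G {x, y})"
      using ec sub unfolding subgraph_def edge_connected_def by (auto simp: add_edge_def)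
    then have "has_ec k (add_edge ?G {x, y})" using ec unfolding has_ec_def by blast
    then show ?thesis unfolding G .
  qed
  have "card (edges ?G) = card (edges ?F) + card (edges ?H) + card (links k t)"
    unfolding edges_eq by (rule saturated_join(2)[OF F H dis sub lt new])
  also have "\<dots> = card (edges ?F) + ((k choose 2) + (k - 1)) + (k - 1)"
    using saturated_H(2)[OF k, of "Suc t"] cl by simp
  finally have "card (edges ?G) + Suc t * ((k - 1) choose 2)
      = (k - 1) * (t * (k + 1) - 1) + (k - 1) * k + (k - 1)"
    using step.IH choose_two_add_pred[of k] k unfolding mult_Suc by linarith
  also have "\<dots> = (k - 1) * ((t * (k + 1) - 1) + k + 1)" by (simp add: algebra_simps)
  also have "(t * (k + 1) - 1) + k + 1 = Suc t * (k + 1) - 1"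
    using step by (cases t) auto
  finally have count: "card (edges ?G) + Suc t * ((k - 1) choose 2) = (k - 1) * (Suc t * (k + 1) - 1)" .
  have "saturated (edge_connected_family k) ?G"
    unfolding G by (rule saturated_join(1)[OF F H dis sub lt new])
  with count show ?case by blast
qed

lemma F_graph_eq_chain: "F_graph k t = chain_graph k 1 t"
proof -
  have *: "{1..t-1} = {1..<t}" by auto
  have "{{u_vertex k i j, u_vertex k (i+1) j} | i j. i \<in> {1..<t} \<and> j \<in> {1..k+1} - {2, k}} =
      (\<Union>i\<in>{1..<t}. links k i)"
    unfolding links_def set_eq_iff by blast
  then show ?thesis unfolding F_graph_def chain_graph_def verts_H * by simp
qed

text \<open>The graph \<open>G\<^bsub>k,n\<^esub>\<close> with \<open>n = t * (k + 1) + r\<close>; here \<open>r\<close> is unbounded, which lets the vertices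
  \<open>w\<^sub>l\<close> be attached one at a time.\<close>

definition extended_chain :: "nat \<Rightarrow> nat \<Rightarrow> nat \<Rightarrow> nat graph" where
  "extended_chain k t r = (verts (chain_graph k 1 t) \<union> w_vertex k t ` {1..r},
     edges (chain_graph k 1 t) \<union>
       cross (w_vertex k t ` {1..r}) (block k t - {u_vertex k t 1, u_vertex k t (k+1)}))"

lemma G_graph_eq_extended_chain:
  "G_graph k n = extended_chain k (n div (k + 1)) (n - n div (k + 1) * (k + 1))"
proof -
  have *: "{{w_vertex k t l, x} | l x. l \<in> {1..r} \<and> x \<in> N} = cross (w_vertex k t ` {1..r}) N" for t r N
    unfolding set_eq_iff cross_iff by blast
  show ?thesis
    unfolding G_graph_def extended_chain_def F_graph_eq_chain verts_H Let_def fst_conv snd_conv *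
    by (rule refl)
qed

lemma w_vertex_fresh: "1 \<le> l \<Longrightarrow> w_vertex k t l \<notin> verts (chain_graph k 1 t)"
proof
  assume l: "1 \<le> l" and "w_vertex k t l \<in> verts (chain_graph k 1 t)"
  then obtain i j where ij: "1 \<le> i" "i \<le> t" "j \<le> k + 1" "w_vertex k t l = u_vertex k i j"
    by (auto simp: chain_graph_def block_def)
  have "(i - 1) * (k + 1) + (k + 1) = i * (k + 1)" using ij(1) by (cases i) auto
  also have "\<dots> \<le> t * (k + 1)" using ij(2) by (rule mult_le_mono1)
  finally have "u_vertex k i j \<le> t * (k + 1)" using ij(3) unfolding u_vertex_def by linarith
  then show False using l ij(4) unfolding w_vertex_def by simp
qed

text \<open>Let \<open>N\<close> be the common neighbourhood of the vertices \<open>w\<^sub>l\<close>, and let \<open>w\<close> be a further one. An edge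
  from \<open>w\<close> to one of the previous \<open>w\<^sub>l\<close> or to an end of the missing edge of block \<open>t\<close> completes a clique
  together with \<open>N\<close>; an edge from \<open>w\<close> to a block \<open>i < t\<close> makes the stretch from \<open>i\<close> to \<open>t\<close> together
  with \<open>w\<close> \<open>k\<close>-edge-connected.\<close>
lemma saturated_extended_chain:
  assumes k: "3 \<le> k" and t: "1 \<le> t"
  shows "saturated (edge_connected_family k) (extended_chain k t r) \<and>
    card (verts (extended_chain k t r)) = t * (k + 1) + r \<and>
    card (edges (extended_chain k t r)) + t * ((k - 1) choose 2) = (k - 1) * (t * (k + 1) + r - 1)"
proof (induction r)
  case 0
  have "extended_chain k t 0 = chain_graph k 1 t" by (simp add: extended_chain_def cross_def)
  then show ?case using saturated_chain[OF k t] card_verts_chain[of k t] by simp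
next
  case (Suc r)
  let ?F = "chain_graph k 1 t" and ?P = "extended_chain k t r" and ?Q = "extended_chain k t (Suc r)"
  let ?w = "w_vertex k t (Suc r)" and ?N = "block k t - {u_vertex k t 1, u_vertex k t (k+1)}"
  let ?C = "cross ?N {?w}"
  have sat1: "saturated (edge_connected_family k) (verts ?P, edges ?P)" using Suc by simp
  have sat2: "saturated (edge_connected_family k) ({?w}, {})" using k by (intro saturated_singleton) simp
  have wF: "?w \<notin> verts ?F" by (rule w_vertex_fresh) simp
  have "?w \<notin> w_vertex k t ` {1..r}" by (auto simp: w_vertex_def)
  then have wP: "?w \<notin> verts ?P" using wF by (simp add: extended_chain_def)
  then have dis: "verts ?P \<inter> {?w} = {}" by simp
  have blockF: "block k t \<subseteq> verts ?F" using t by (auto simp: chain_graph_def)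
  have HF: "edges (H_graph k t) \<subseteq> edges ?F" using t by (auto simp: chain_graph_def)
  have FP: "verts ?F \<subseteq> verts ?P" "edges ?F \<subseteq> edges ?P" by (auto simp: extended_chain_def)
  have "u_vertex k t 1 \<noteq> u_vertex k t (k+1)" using t k by (simp add: u_vertex_eq_iff)
  then have cN: "card ?N = k - 1"
    using card_block[OF t, of k] finite_block
    by (subst card_Diff_subset) (auto intro: u_vertex_in_block)
  have "?N \<inter> {?w} = {}" using wF blockF by auto
  then have cC: "card ?C = k - 1" using cN by (simp add: card_cross)
  then have lt: "card ?C < k" using k by simp
  have sub: "?C \<subseteq> cross (verts ?P) {?w}"
    using blockF FP(1) unfolding cross_def by blast
  have "w_vertex k t ` {1..Suc r} = insert ?w (w_vertex k t ` {1..r})"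
    by (simp add: atLeastAtMostSuc_conv)
  then have edges_eq: "edges ?Q = edges ?P \<union> {} \<union> ?C"
    and V: "verts ?Q = verts ?P \<union> {?w}"
    by (auto simp: extended_chain_def cross_iff insert_commute)
  have Q: "?Q = (verts ?P \<union> {?w}, edges ?P \<union> {} \<union> ?C)"
    using edges_eq V by (metis prod.collapse)
  have simpleP: "simple_graph ?P" using Suc unfolding saturated_ec_iff by blast
  have simpleQ: "simple_graph ?Q"
    unfolding simple_graph_iff
  proof (intro conjI ballI)
    show "finite (verts ?Q)" unfolding V using simple_finite[OF simpleP] by simp
    fix e assume "e \<in> edges ?Q"
    then consider "e \<in> edges ?P" | "e \<in> cross (verts ?P) {?w}" unfolding edges_eq using sub by auto
    then show "\<exists>x y. e = {x, y} \<and> x \<in> verts ?Q \<and> y \<in> verts ?Q \<and> x \<noteq> y"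
    proof cases
      case 1
      then show ?thesis using simple_edgeE[OF simpleP 1] unfolding V by (metis UnI1)
    next
      case 2
      then obtain x where "x \<in> verts ?P" "e = {x, ?w}" by (auto simp: cross_iff)
      then show ?thesis using wP unfolding V by (intro exI[of _ x] exI[of _ ?w]) auto
    qed
  qed
  have new: "has_ec k (add_edge (verts ?P \<union> {?w}, edges ?P \<union> {} \<union> ?C) {x, y})"
    if x: "x \<in> verts ?P" and y: "y \<in> {?w}" and xy: "{x, y} \<notin> ?C" for x y
  proof -
    have y: "y = ?w" using y by simp
    have xN: "x \<notin> ?N" using xy y by (auto simp: cross_iff)
    have xw: "x \<noteq> ?w" using x wP by auto
    let ?A = "add_edge ?Q {x, ?w}"
    have simpleA: "simple_graph ?A" using simple_add_pair[OF simpleQ _ _ xw] x by (simp add: V)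
    have wN: "{?w, z} \<in> edges ?Q" if "z \<in> ?N" for z
      using that unfolding edges_eq by (auto simp: cross_iff insert_commute)
    have "has_ec k ?A"
    proof (cases "\<exists>i. 1 \<le> i \<and> i < t \<and> x \<in> block k i")
      case True
      then obtain i where i: "1 \<le> i" "i < t" "x \<in> block k i" by blast
      let ?K = "chain_graph k i t"
      let ?L = "(insert ?w (verts ?K), edges ?K \<union> cross {?w} (insert x ?N))"
      have KF: "subgraph ?K ?F" using subgraph_chain i by simp
      then have "?w \<notin> verts ?K" using wF unfolding subgraph_def by blast
      then have ec: "edge_connected k ?L"
        using edge_connected_chain_add_vertex[OF k i, of ?N ?w] cN by auto
      have "edges ?L \<subseteq> edges ?A"
      proof
        fix e assume "e \<in> edges ?L"
        then consider "e \<in> edges ?F" | "e = {?w, x}" | z where "z \<in> ?N" "e = {?w, z}"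
          using KF unfolding subgraph_def by (auto simp: cross_iff)
        then show "e \<in> edges ?A"
          using FP wN by cases (auto simp: add_edge_def edges_eq insert_commute)
      qed
      moreover have "verts ?L \<subseteq> verts ?A"
        using KF FP unfolding subgraph_def by (auto simp: add_edge_def V)
      ultimately have "subgraph ?L ?A"
        using ec simpleA unfolding subgraph_def edge_connected_def by blast
      then show ?thesis using ec unfolding has_ec_def by blast
    next
      case False
      have xz: "{x, z} \<in> edges ?P" if z: "z \<in> ?N" for z
      proof -
        from x consider "x \<in> w_vertex k t ` {1..r}" | i where "1 \<le> i" "i \<le> t" "x \<in> block k i"
          by (auto simp: extended_chain_def chain_graph_def)
        then show ?thesis
        proof cases
          case 1
          then show ?thesis using z by (auto simp: extended_chain_def cross_iff)
        next
          case 2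
          then have "x \<in> block k t" using False by (cases "i = t") auto
          then have "{x, z} \<in> edges (H_graph k t)"
            using z xN by (subst H_edge_iff) (auto simp: doubleton_eq_iff)
          then show ?thesis using HF FP(2) by blast
        qed
      qed
      show ?thesis
      proof (rule has_ec_of_clique[of _ "insert x (insert ?w ?N)"])
        show "simple_graph ?A" by (rule simpleA)
        show "insert x (insert ?w ?N) \<subseteq> verts ?A"
          using x blockF FP by (auto simp: add_edge_def V)
        show "card (insert x (insert ?w ?N)) = k + 1"
          using xN xw \<open>?N \<inter> {?w} = {}\<close> cN k finite_block by (simp add: card_insert_if)
        show "1 \<le> k" using k by simp
        fix p q assume pq: "p \<in> insert x (insert ?w ?N)" "q \<in> insert x (insert ?w ?N)" "p \<noteq> q"
        have NN: "{p, q} \<in> edges ?Q" if "p \<in> ?N" "q \<in> ?N"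
        proof -
          have "{p, q} \<in> edges (H_graph k t)"
            using that pq(3) by (subst H_edge_iff) (auto simp: doubleton_eq_iff)
          then show ?thesis using HF FP(2) edges_eq by blast
        qed
        have xQ: "{x, z} \<in> edges ?Q" if "z \<in> ?N" for z using xz[OF that] edges_eq by auto
        consider "{p, q} = {x, ?w}" | z where "z \<in> ?N" "{p, q} = {x, z}"
          | z where "z \<in> ?N" "{p, q} = {?w, z}" | "p \<in> ?N" "q \<in> ?N"
          using pq by (auto simp: insert_commute)
        then have "{p, q} = {x, ?w} \<or> {p, q} \<in> edges ?Q"
          using xQ wN NN by cases metis+
        then show "{p, q} \<in> edges ?A" by (auto simp: add_edge_def)
      qed
    qed
    then show ?thesis unfolding Q y .
  qed
  have "card (edges ?Q) = card (edges ?P) + card ({} :: nat set set) + card ?C"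
    unfolding edges_eq by (rule saturated_join(2)[OF sat1 sat2 dis sub lt new])
  then have "card (edges ?Q) + t * ((k - 1) choose 2) = (k - 1) * (t * (k + 1) + r - 1) + (k - 1)"
    using Suc cC by simp
  also have "\<dots> = (k - 1) * ((t * (k + 1) + r - 1) + 1)" by (simp add: algebra_simps)
  also have "(t * (k + 1) + r - 1) + 1 = t * (k + 1) + Suc r - 1" using t by (cases t) auto
  finally have "card (edges ?Q) + t * ((k - 1) choose 2) = (k - 1) * (t * (k + 1) + Suc r - 1)" .
  moreover have "card (verts ?Q) = t * (k + 1) + Suc r"
    using Suc wP simple_finite[OF simpleP] unfolding V by simp
  moreover have "saturated (edge_connected_family k) ?Q"
    unfolding Q by (rule saturated_join(1)[OF sat1 sat2 dis sub lt new])
  ultimately show ?case by blast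
qed

lemma attains_sat_of_lower_bound:
  assumes k: "1 \<le> k" and n: "k + 1 \<le> n"
    and G: "saturated (edge_connected_family k) G" "card (verts G) = n"
      "card (edges G) + n div (k + 1) * ((k - 1) choose 2) = (k - 1) * (n - 1)"
  shows "sat n (edge_connected_family k) = card (edges G)"
    and "attains_sat n (edge_connected_family k) G"
proof -
  show s: "sat n (edge_connected_family k) = card (edges G)"
    unfolding sat_def
  proof (rule Least_equality)
    fix m assume "\<exists>G :: nat graph. saturated (edge_connected_family k) G \<and>
      card (verts G) = n \<and> card (edges G) = m"
    then obtain G' :: "nat graph" where
      "saturated (edge_connected_family k) G'" "card (verts G') = n" "card (edges G') = m" by blast
    then show "card (edges G) \<le> m"
      using saturated_edges_lower_bound[OF k, of G'] n G(3) by simp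
  qed (use G in blast)
  show "attains_sat n (edge_connected_family k) G"
    unfolding attains_sat_def using s G by simp
qed

theorem theorem3p4:
  fixes k n t :: nat
  assumes "k \<ge> 1" and "n \<ge> k + 1" and "t = n div (k + 1)"
  shows "int (sat n (edge_connected_family k))
           = (int k - 1) * (int n - 1) - int t * int ((k - 1) choose 2)
       \<and> (k = 1 \<longrightarrow> (\<forall>V. card V = n \<longrightarrow> attains_sat n (edge_connected_family k) (V, {})))
       \<and> (k = 2 \<longrightarrow> (\<forall>T. tree T \<and> card (verts T) = n \<longrightarrow>
             attains_sat n (edge_connected_family k) T))
       \<and> (k \<ge> 3 \<longrightarrow> attains_sat n (edge_connected_family k) (G_graph k n))"
proof -
  let ?F = "edge_connected_family k :: nat graph set"
  let ?tight = "\<lambda>G :: nat graph. saturated ?F G \<and> card (verts G) = n \<and>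
    card (edges G) + t * ((k - 1) choose 2) = (k - 1) * (n - 1)"
  have attains: "attains_sat n ?F G" "sat n ?F = card (edges G)" if "?tight G" for G
    using attains_sat_of_lower_bound[OF assms(1,2), of G] that assms(3) by auto
  have one: "?tight (V, {})" if "k = 1" "card V = n" for V
  proof -
    have "finite V" using that assms(2) by (intro card_ge_0_finite) simp
    then show ?thesis using saturated_edgeless that by simp
  qed
  have two: "?tight T" if "k = 2" "tree T" "card (verts T) = n" for T
    using saturated_tree[OF that(2)] that by simp
  have star: "?tight (insert 0 {1..<n}, cross {0} {1..<n})" if "k = 2"
    using saturated_star[of "{1..<n}" 0] that assms(2) by (simp add: card_cross binomial_eq_0)
  have three: "?tight (G_graph k n)" if "3 \<le> k"
  proof -
    have "1 \<le> t" using assms by (metis div_le_mono div_self add_is_0 one_neq_zero)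
    moreover have "t * (k + 1) + (n - t * (k + 1)) = n"
      using assms(3) by (metis div_times_less_eq_dividend le_add_diff_inverse)
    ultimately show ?thesis
      using saturated_extended_chain[OF that, of t "n - t * (k + 1)"]
      unfolding G_graph_eq_extended_chain assms(3)[symmetric] by simp
  qed
  have "\<exists>G. ?tight G"
  proof -
    consider "k = 1" | "k = 2" | "3 \<le> k" using assms(1) by linarith
    then show ?thesis using one[OF _ card_lessThan] star three by cases (blast, blast, blast)
  qed
  then obtain G where G: "?tight G" by blast
  then have "int (card (edges G)) + int t * int ((k - 1) choose 2) = int ((k - 1) * (n - 1))"
    by (metis of_nat_add of_nat_mult)
  also have "\<dots> = (int k - 1) * (int n - 1)" using assms by (simp add: of_nat_diff)
  finally have "int (sat n ?F) = (int k - 1) * (int n - 1) - int t * int ((k - 1) choose 2)"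
    using attains(2)[OF G] by simp
  then show ?thesis using attains(1) one two three by blast
qed

end
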